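(* Let $X,Y,Z$ be real Banach spaces, where $Z$ has the Daugavet property. Let $B_0: X\times Y\to Z$ be a norming bilinear map and let $B: X\times Y\to Z$ be a continuous bilinear map. Then: (1) If for every $\varepsilon>0$ there are a slice $S_0\in S_{B_0}$ and an element $z\in S_Z$ such that $B(S_0)\subset B_\varepsilon(z)$, then $$\|B_0+B\|=1+\|B\|.$$ (2) If $S_{T_B}\le S_{B_0}$ and $T_B$ is weakly compact (equivalently, $B(B_X\times B_Y)$ is a relatively weakly compact set), then $$\|B_0+B\|=1+\|B\|.$$
   Context: All Banach spaces are real. $B_X$, $U_X$, $S_X$ denote the closed unit ball, the open unit ball and the unit sphere of $X$; $X'$ is the dual space; $T'$ is the adjoint of an operator $T$; $B_\varepsilon(z)$ is the closed ball with centre $z$ and radius $\varepsilon$. The norm of a continuous bilinear map $B: X\times Y\to Z$ is $\|B\|=\sup\{\|B(x,y)\|: x\in B_X, y\in B_Y\}$. A Banach space $Z$ has the Daugavet property if $\|\mathrm{Id}+Q\|=1+\|Q\|$ for every rank one continuous linear operator $Q: Z\to Z$. A continuous bilinear map $B_0: X\times Y\to Z$ is called norming if $B_0(U_X\times U_Y)=U_Z$ (in particular $\|B_0\|=1$). $T_B: X\hat\otimes_\pi Y\to Z$ denotes the linearisation of $B$, i.e. the continuous linear operator on the projective tensor product with $T_B(x\otimes y)=B(x,y)$. Slices for bilinear maps: for a norm one bilinear form $b: X\times Y\to\mathbb R$ and $0<\varepsilon<1$, put $S(b,\varepsilon)=\{(x,y): x\in B_X,\ y\in B_Y,\ b(x,y)\ge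 1-\varepsilon\}$. For a continuous bilinear map $B: X\times Y\to Z$ and $z'\in S_{Z'}$ let $\langle B,z'\rangle(x,y)=\langle B(x,y),z'\rangle$ and, when $\|\langle B,z'\rangle\|\ne 0$, $B_{z'}=\langle B,z'\rangle/\|\langle B,z'\rangle\|$. Then $S_B=\{S(B_{z'},\varepsilon): 0<\varepsilon<1,\ z'\in S_{Z'},\ \|\langle B,z'\rangle\|\neq 0\}$. Slices for linear operators: for a Banach space $E$, a norm one $e'\in E'$ and $\varepsilon>0$, $S(e',\varepsilon)=\{e\in B_E: \langle e,e'\rangle\ge 1-\varepsilon\}$; for a continuous linear operator $T: E\to Z$, $S_T=\{S(T'(z')/\|T'(z')\|,\varepsilon): 0<\varepsilon<1,\ z'\in Z',\ T'(z')\ne 0\}$. The relation $S_{T_B}\le S_{B_0}$ means: for every $S\in S_{T_B}$ there is a slice $S_1\in S_{B_0}$ such that $\{x\otimes y: (x,y)\in S_1\}\subset S$.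
   Formalization: In (1) the condition B(S_0) ⊂ B_ε(z) is replaced by B(S_0) ⊂ B_ε(‖B‖z), z in S_Z, since (1) as written fails for ‖B‖ > 1 (the two agree for ‖B‖ = 1); Z is assumed nonzero; the equivalent form of weak compactness in (2) is not stated. *)

theory Defs
  imports "HOL-Analysis.Analysis"
begin

section \<open>The algebraic tensor product\<close>

text \<open>
  A list of pairs \<open>(x\<^sub>i, y\<^sub>i)\<close> stands for the formal sum of the elementary tensors
  \<open>x\<^sub>i \<otimes> y\<^sub>i\<close> (scalars are absorbed into the first factor). Two formal sums are the same
  tensor iff every bilinear form, continuous or not, takes the same value on them: the algebraic
  tensor product is realised inside the algebraic dual of the space of bilinear forms.
\<close>

definition formal_sum :: "('a \<Rightarrow> 'b \<Rightarrow> 'c::monoid_add) \<Rightarrow> ('a \<times> 'b) list \<Rightarrow> 'c" where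
  "formal_sum b us = (\<Sum>(x, y)\<leftarrow>us. b x y)"

definition tensor_eq ::
    "('a::real_vector \<times> 'b::real_vector) list \<Rightarrow> ('a \<times> 'b) list \<Rightarrow> bool" where
  "tensor_eq us vs \<longleftrightarrow>
     (\<forall>b :: 'a \<Rightarrow> 'b \<Rightarrow> real. bilinear b \<longrightarrow> formal_sum b us = formal_sum b vs)"

quotient_type (overloaded) ('a, 'b) alg_tensor =
    "('a::real_vector \<times> 'b::real_vector) list" / tensor_eq
  by (rule equivpI) (auto simp: tensor_eq_def reflp_def symp_def transp_def)

lemma formal_sum_simps [simp]:
  "formal_sum b [] = 0"
  "formal_sum b ((x, y) # us) = b x y + formal_sum b us"
  "formal_sum b (us @ vs) = formal_sum b us + formal_sum b vs"
  by (simp_all add: formal_sum_def)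

lemma formal_sum_scale:
  assumes "bilinear b"
  shows "formal_sum b (map (\<lambda>(x, y). (c *\<^sub>R x, y)) us) = c *\<^sub>R formal_sum b us"
  by (induction us) (auto simp: bilinear_lmul[OF assms] scaleR_add_right)

instantiation alg_tensor :: (real_vector, real_vector) real_vector
begin

lift_definition zero_alg_tensor :: "('a, 'b) alg_tensor" is "[]" .

lift_definition plus_alg_tensor ::
  "('a, 'b) alg_tensor \<Rightarrow> ('a, 'b) alg_tensor \<Rightarrow> ('a, 'b) alg_tensor" is "(@)"
  by (simp add: tensor_eq_def)

lift_definition scaleR_alg_tensor ::
  "real \<Rightarrow> ('a, 'b) alg_tensor \<Rightarrow> ('a, 'b) alg_tensor" is "\<lambda>c. map (\<lambda>(x, y). (c *\<^sub>R x, y))"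
  by (simp add: tensor_eq_def formal_sum_scale)

definition uminus_alg_tensor :: "('a, 'b) alg_tensor \<Rightarrow> ('a, 'b) alg_tensor" where
  "uminus_alg_tensor u = (- 1) *\<^sub>R u"

definition minus_alg_tensor ::
  "('a, 'b) alg_tensor \<Rightarrow> ('a, 'b) alg_tensor \<Rightarrow> ('a, 'b) alg_tensor" where
  "minus_alg_tensor u v = u + (- v)"

instance
proof
  fix u v w :: "('a, 'b) alg_tensor" and a c :: real
  show "u + v + w = u + (v + w)"
    by transfer (simp add: tensor_eq_def)
  show "u + v = v + u"
    by transfer (simp add: tensor_eq_def)
  show "0 + u = u"
    by transfer (simp add: tensor_eq_def)
  show "- u + u = 0"
    unfolding uminus_alg_tensor_def
    by transfer (simp add: tensor_eq_def formal_sum_scale[where c = "- 1", simplified])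
  show "u - v = u + - v"
    by (fact minus_alg_tensor_def)
  show "a *\<^sub>R (u + v) = a *\<^sub>R u + a *\<^sub>R v"
    by transfer (simp add: tensor_eq_def)
  show "(a + c) *\<^sub>R u = a *\<^sub>R u + c *\<^sub>R u"
    by transfer (simp add: tensor_eq_def formal_sum_scale distrib_right)
  show "a *\<^sub>R c *\<^sub>R u = (a * c) *\<^sub>R u"
    by transfer (simp add: tensor_eq_def formal_sum_scale del: map_map)
  show "1 *\<^sub>R u = u"
    by transfer (simp add: tensor_eq_def formal_sum_scale)
qed

end

lift_definition alg_tensor :: "'a::real_vector \<Rightarrow> 'b::real_vector \<Rightarrow> ('a, 'b) alg_tensor"
  is "\<lambda>x y. [(x, y)]" .


section \<open>The projective norm\<close>

definition proj_norm :: "('a::real_normed_vector, 'b::real_normed_vector) alg_tensor \<Rightarrow> real" where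
  "proj_norm u = Inf {formal_sum (\<lambda>x y. norm x * norm y) us | us. abs_alg_tensor us = u}"

lemma formal_sum_norm_nonneg: "0 \<le> formal_sum (\<lambda>x y. norm x * norm y) us"
  by (induction us) (auto simp: add_nonneg_nonneg)

lemma proj_norm_le: "proj_norm (abs_alg_tensor us) \<le> formal_sum (\<lambda>x y. norm x * norm y) us"
  unfolding proj_norm_def
  by (rule cInf_lower) (auto intro!: bdd_belowI[of _ 0] formal_sum_norm_nonneg)

lemma alg_tensor_rep_ex: "\<exists>us. abs_alg_tensor us = u"
  by (metis Quotient3_abs_rep Quotient3_alg_tensor)

lemma proj_norm_greatest:
  assumes "\<And>us. abs_alg_tensor us = u \<Longrightarrow> c \<le> formal_sum (\<lambda>x y. norm x * norm y) us"
  shows "c \<le> proj_norm u"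
  unfolding proj_norm_def
  by (rule cInf_greatest) (use alg_tensor_rep_ex[of u] assms in auto)

lemma proj_norm_nonneg: "0 \<le> proj_norm u"
  by (rule proj_norm_greatest) (rule formal_sum_norm_nonneg)

lemma proj_norm_approx:
  assumes "e > 0"
  obtains us where "abs_alg_tensor us = u" "formal_sum (\<lambda>x y. norm x * norm y) us < proj_norm u + e"
proof -
  have "\<not> (\<forall>us. abs_alg_tensor us = u \<longrightarrow> proj_norm u + e \<le> formal_sum (\<lambda>x y. norm x * norm y) us)"
    using proj_norm_greatest[of u "proj_norm u + e"] assms by auto
  then show ?thesis using that by force
qed

lemma proj_norm_zero [simp]: "proj_norm 0 = 0"
  using proj_norm_le[of "[]"] proj_norm_nonneg[of 0]
  by (metis formal_sum_simps(1) order_antisym zero_alg_tensor.abs_eq)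

lemma proj_norm_triangle: "proj_norm (u + v) \<le> proj_norm u + proj_norm v"
proof (rule field_le_epsilon)
  fix e :: real assume "e > 0"
  obtain us where us: "abs_alg_tensor us = u"
      "formal_sum (\<lambda>x y. norm x * norm y) us < proj_norm u + e / 2"
    using proj_norm_approx[of "e / 2"] \<open>e > 0\<close> by auto
  obtain vs where vs: "abs_alg_tensor vs = v"
      "formal_sum (\<lambda>x y. norm x * norm y) vs < proj_norm v + e / 2"
    using proj_norm_approx[of "e / 2"] \<open>e > 0\<close> by auto
  have "abs_alg_tensor (us @ vs) = u + v"
    using us vs plus_alg_tensor.abs_eq by metis
  then have "proj_norm (u + v) \<le> formal_sum (\<lambda>x y. norm x * norm y) (us @ vs)"
    using proj_norm_le by metis
  then show "proj_norm (u + v) \<le> proj_norm u + proj_norm v + e"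
    using us vs by simp
qed

lemma proj_norm_scaleR_le: "proj_norm (c *\<^sub>R u) \<le> \<bar>c\<bar> * proj_norm u"
proof (rule field_le_epsilon)
  fix e :: real assume e: "e > 0"
  define d where "d = e / (\<bar>c\<bar> + 1)"
  have d: "d > 0" "\<bar>c\<bar> * d \<le> e"
    using e by (auto simp: d_def field_simps)
  obtain us where us: "abs_alg_tensor us = u"
      "formal_sum (\<lambda>x y. norm x * norm y) us < proj_norm u + d"
    using proj_norm_approx[OF d(1)] by auto
  have "abs_alg_tensor (map (\<lambda>(x, y). (c *\<^sub>R x, y)) us) = c *\<^sub>R u"
    using us scaleR_alg_tensor.abs_eq by metis
  then have "proj_norm (c *\<^sub>R u)
      \<le> formal_sum (\<lambda>x y. norm x * norm y) (map (\<lambda>(x, y). (c *\<^sub>R x, y)) us)"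
    using proj_norm_le by metis
  also have "\<dots> = \<bar>c\<bar> * formal_sum (\<lambda>x y. norm x * norm y) us"
    by (induction us) (auto simp: algebra_simps)
  also have "\<dots> \<le> \<bar>c\<bar> * (proj_norm u + d)"
    using us by (intro mult_left_mono) auto
  finally show "proj_norm (c *\<^sub>R u) \<le> \<bar>c\<bar> * proj_norm u + e"
    using d by (simp add: algebra_simps)
qed

lemma proj_norm_scaleR: "proj_norm (c *\<^sub>R u) = \<bar>c\<bar> * proj_norm u"
proof (cases "c = 0")
  case False
  have "proj_norm u = proj_norm (inverse c *\<^sub>R c *\<^sub>R u)"
    using False by simp
  also have "\<dots> \<le> \<bar>inverse c\<bar> * proj_norm (c *\<^sub>R u)"
    by (rule proj_norm_scaleR_le)
  finally have "\<bar>c\<bar> * proj_norm u \<le> proj_norm (c *\<^sub>R u)"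
    using False by (simp add: field_simps abs_inverse)
  then show ?thesis using proj_norm_scaleR_le[of c u] by simp
qed simp

lemma proj_norm_minus_commute: "proj_norm (u - v) = proj_norm (v - u)"
  using proj_norm_scaleR[of "- 1" "u - v"] by (simp add: algebra_simps)

lemma proj_norm_diff_triangle: "proj_norm (u - w) \<le> proj_norm (u - v) + proj_norm (v - w)"
  using proj_norm_triangle[of "u - v" "v - w"] by simp

lemma proj_norm_abs_diff: "\<bar>proj_norm u - proj_norm v\<bar> \<le> proj_norm (u - v)"
  using proj_norm_triangle[of "u - v" v] proj_norm_triangle[of "v - u" u]
  by (simp add: proj_norm_minus_commute[of u v])


section \<open>The projective tensor product\<close>

text \<open>
  The completion of the algebraic tensor product in the projective norm: Cauchy sequences modulo
  null sequences. (The projective norm is definite, by the Hahn--Banach theorem; the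
  construction does not use this.)
\<close>

definition tensor_cauchy ::
    "(nat \<Rightarrow> ('a::real_normed_vector, 'b::real_normed_vector) alg_tensor) \<Rightarrow> bool" where
  "tensor_cauchy s \<longleftrightarrow> (\<forall>e>0. \<exists>N. \<forall>m\<ge>N. \<forall>n\<ge>N. proj_norm (s m - s n) < e)"

definition tensor_cauchy_eq ::
    "(nat \<Rightarrow> ('a::real_normed_vector, 'b::real_normed_vector) alg_tensor) \<Rightarrow>
     (nat \<Rightarrow> ('a, 'b) alg_tensor) \<Rightarrow> bool" where
  "tensor_cauchy_eq s t \<longleftrightarrow>
     tensor_cauchy s \<and> tensor_cauchy t \<and> (\<lambda>n. proj_norm (s n - t n)) \<longlonglongrightarrow> 0"

lemma tensor_cauchy_const [simp]: "tensor_cauchy (\<lambda>_. u)"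
  by (simp add: tensor_cauchy_def)

lemma tensor_cauchy_add:
  assumes "tensor_cauchy s" "tensor_cauchy t"
  shows "tensor_cauchy (\<lambda>n. s n + t n)"
  unfolding tensor_cauchy_def
proof (intro allI impI)
  fix e :: real assume "e > 0"
  then have "e / 2 > 0" by simp
  obtain M where M: "\<And>m n. m \<ge> M \<Longrightarrow> n \<ge> M \<Longrightarrow> proj_norm (s m - s n) < e / 2"
    using assms(1) \<open>e / 2 > 0\<close> unfolding tensor_cauchy_def by blast
  obtain N where N: "\<And>m n. m \<ge> N \<Longrightarrow> n \<ge> N \<Longrightarrow> proj_norm (t m - t n) < e / 2"
    using assms(2) \<open>e / 2 > 0\<close> unfolding tensor_cauchy_def by blast
  have "proj_norm (s m + t m - (s n + t n)) < e" if "m \<ge> max M N" "n \<ge> max M N" for m n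
    using M[of m n] N[of m n] that proj_norm_triangle[of "s m - s n" "t m - t n"]
    by (simp add: algebra_simps)
  then show "\<exists>N. \<forall>m\<ge>N. \<forall>n\<ge>N. proj_norm (s m + t m - (s n + t n)) < e" by blast
qed

lemma tensor_cauchy_scaleR:
  assumes "tensor_cauchy s"
  shows "tensor_cauchy (\<lambda>n. c *\<^sub>R s n)"
  unfolding tensor_cauchy_def
proof (intro allI impI)
  fix e :: real assume "e > 0"
  then have "e / (\<bar>c\<bar> + 1) > 0" by simp
  then obtain N where N: "\<And>m n. m \<ge> N \<Longrightarrow> n \<ge> N \<Longrightarrow> proj_norm (s m - s n) < e / (\<bar>c\<bar> + 1)"
    using assms unfolding tensor_cauchy_def by blast
  have "proj_norm (c *\<^sub>R s m - c *\<^sub>R s n) < e" if "m \<ge> N" "n \<ge> N" for m n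
  proof -
    have "proj_norm (c *\<^sub>R s m - c *\<^sub>R s n) = \<bar>c\<bar> * proj_norm (s m - s n)"
      by (metis proj_norm_scaleR scaleR_right_diff_distrib)
    also have "\<dots> \<le> (\<bar>c\<bar> + 1) * proj_norm (s m - s n)"
      by (intro mult_right_mono) (auto simp: proj_norm_nonneg)
    also have "\<dots> < (\<bar>c\<bar> + 1) * (e / (\<bar>c\<bar> + 1))"
      using N[OF that] by (intro mult_strict_left_mono) auto
    also have "\<dots> = e" by (simp add: field_simps)
    finally show ?thesis .
  qed
  then show "\<exists>N. \<forall>m\<ge>N. \<forall>n\<ge>N. proj_norm (c *\<^sub>R s m - c *\<^sub>R s n) < e" by blast
qed

lemma proj_null_triangle:
  assumes "(\<lambda>n. proj_norm (s n)) \<longlonglongrightarrow> 0" "(\<lambda>n. proj_norm (t n)) \<longlonglongrightarrow> 0"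
    and "\<And>n. proj_norm (r n) \<le> proj_norm (s n) + proj_norm (t n)"
  shows "(\<lambda>n. proj_norm (r n)) \<longlonglongrightarrow> 0"
  by (rule tendsto_sandwich[OF _ _ tendsto_const tendsto_add_zero[OF assms(1,2)]])
     (auto simp: proj_norm_nonneg assms(3))

quotient_type (overloaded) ('a, 'b) proj_tensor =
    "nat \<Rightarrow> ('a::real_normed_vector, 'b::real_normed_vector) alg_tensor" / partial: tensor_cauchy_eq
proof (rule part_equivpI)
  show "\<exists>s. tensor_cauchy_eq s s"
    by (rule exI[of _ "\<lambda>_. 0"]) (simp add: tensor_cauchy_eq_def)
  show "symp tensor_cauchy_eq"
    by (auto simp: symp_def tensor_cauchy_eq_def proj_norm_minus_commute)
  show "transp tensor_cauchy_eq"
  proof (rule transpI)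
    fix r s t
    assume rs: "tensor_cauchy_eq r s" and st: "tensor_cauchy_eq s t"
    have "(\<lambda>n. proj_norm (r n - t n)) \<longlonglongrightarrow> 0"
      using rs st unfolding tensor_cauchy_eq_def
      by (intro proj_null_triangle[of "\<lambda>n. r n - s n" "\<lambda>n. s n - t n" "\<lambda>n. r n - t n"]
          proj_norm_diff_triangle) auto
    then show "tensor_cauchy_eq r t"
      using rs st by (simp add: tensor_cauchy_eq_def)
  qed
qed

lemma convergent_proj_norm:
  assumes "tensor_cauchy s"
  shows "convergent (\<lambda>n. proj_norm (s n))"
proof -
  have "Cauchy (\<lambda>n. proj_norm (s n))"
    unfolding Cauchy_def dist_real_def
    using assms proj_norm_abs_diff unfolding tensor_cauchy_def by (meson order_le_less_trans)
  then show ?thesis by (rule Cauchy_convergent)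
qed

instantiation proj_tensor :: (real_normed_vector, real_normed_vector) real_normed_vector
begin

lift_definition zero_proj_tensor :: "('a, 'b) proj_tensor" is "\<lambda>_. 0"
  by (simp add: tensor_cauchy_eq_def)

lift_definition plus_proj_tensor ::
  "('a, 'b) proj_tensor \<Rightarrow> ('a, 'b) proj_tensor \<Rightarrow> ('a, 'b) proj_tensor" is "\<lambda>s t n. s n + t n"
proof -
  fix s s' t t' :: "nat \<Rightarrow> ('a, 'b) alg_tensor"
  assume s: "tensor_cauchy_eq s s'" and t: "tensor_cauchy_eq t t'"
  have "proj_norm (s n + t n - (s' n + t' n)) \<le> proj_norm (s n - s' n) + proj_norm (t n - t' n)" for n
    using proj_norm_triangle[of "s n - s' n" "t n - t' n"] by (simp add: algebra_simps)
  then have "(\<lambda>n. proj_norm (s n + t n - (s' n + t' n))) \<longlonglongrightarrow> 0"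
    using s t unfolding tensor_cauchy_eq_def
    by (intro proj_null_triangle[of "\<lambda>n. s n - s' n" "\<lambda>n. t n - t' n"
          "\<lambda>n. s n + t n - (s' n + t' n)"]) auto
  then show "tensor_cauchy_eq (\<lambda>n. s n + t n) (\<lambda>n. s' n + t' n)"
    using s t by (simp add: tensor_cauchy_eq_def tensor_cauchy_add)
qed

lift_definition scaleR_proj_tensor ::
  "real \<Rightarrow> ('a, 'b) proj_tensor \<Rightarrow> ('a, 'b) proj_tensor" is "\<lambda>c s n. c *\<^sub>R s n"
proof -
  fix c :: real and s s' :: "nat \<Rightarrow> ('a, 'b) alg_tensor"
  assume s: "tensor_cauchy_eq s s'"
  have "(\<lambda>n. \<bar>c\<bar> * proj_norm (s n - s' n)) \<longlonglongrightarrow> 0"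
    using s unfolding tensor_cauchy_eq_def by (intro tendsto_mult_right_zero) auto
  moreover have "\<bar>c\<bar> * proj_norm (s n - s' n) = proj_norm (c *\<^sub>R s n - c *\<^sub>R s' n)" for n
    by (metis proj_norm_scaleR scaleR_right_diff_distrib)
  ultimately have "(\<lambda>n. proj_norm (c *\<^sub>R s n - c *\<^sub>R s' n)) \<longlonglongrightarrow> 0" by simp
  then show "tensor_cauchy_eq (\<lambda>n. c *\<^sub>R s n) (\<lambda>n. c *\<^sub>R s' n)"
    using s by (simp add: tensor_cauchy_eq_def tensor_cauchy_scaleR)
qed

lift_definition norm_proj_tensor :: "('a, 'b) proj_tensor \<Rightarrow> real"
  is "\<lambda>s. lim (\<lambda>n. proj_norm (s n))"
proof -
  fix s t :: "nat \<Rightarrow> ('a, 'b) alg_tensor"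
  assume st: "tensor_cauchy_eq s t"
  have "(\<lambda>n. \<bar>proj_norm (s n) - proj_norm (t n)\<bar>) \<longlonglongrightarrow> 0"
    by (rule tendsto_sandwich[OF _ _ tendsto_const, of _ _ _ "\<lambda>n. proj_norm (s n - t n)"])
       (use st in \<open>auto simp: tensor_cauchy_eq_def proj_norm_abs_diff\<close>)
  then have "(\<lambda>n. proj_norm (s n) - proj_norm (t n)) \<longlonglongrightarrow> 0"
    by (simp add: tendsto_rabs_zero_iff)
  moreover have "(\<lambda>n. proj_norm (t n)) \<longlonglongrightarrow> lim (\<lambda>n. proj_norm (t n))"
    using st convergent_proj_norm convergent_LIMSEQ_iff unfolding tensor_cauchy_eq_def by blast
  ultimately have "(\<lambda>n. proj_norm (s n)) \<longlonglongrightarrow> lim (\<lambda>n. proj_norm (t n))"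
    using tendsto_add by fastforce
  then show "lim (\<lambda>n. proj_norm (s n)) = lim (\<lambda>n. proj_norm (t n))"
    by (rule limI)
qed

definition uminus_proj_tensor :: "('a, 'b) proj_tensor \<Rightarrow> ('a, 'b) proj_tensor" where
  "uminus_proj_tensor u = (- 1) *\<^sub>R u"

definition minus_proj_tensor ::
  "('a, 'b) proj_tensor \<Rightarrow> ('a, 'b) proj_tensor \<Rightarrow> ('a, 'b) proj_tensor" where
  "minus_proj_tensor u v = u + (- v)"

definition dist_proj_tensor :: "('a, 'b) proj_tensor \<Rightarrow> ('a, 'b) proj_tensor \<Rightarrow> real" where
  "dist_proj_tensor u v = norm (u - v)"

definition sgn_proj_tensor :: "('a, 'b) proj_tensor \<Rightarrow> ('a, 'b) proj_tensor" where
  "sgn_proj_tensor u = inverse (norm u) *\<^sub>R u"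

definition [code del]:
  "(uniformity :: (('a, 'b) proj_tensor \<times> ('a, 'b) proj_tensor) filter) =
     (INF e\<in>{0 <..}. principal {(u, v). dist u v < e})"

definition open_proj_tensor :: "('a, 'b) proj_tensor set \<Rightarrow> bool" where [code del]:
  "open_proj_tensor U \<longleftrightarrow> (\<forall>u\<in>U. eventually (\<lambda>(u', v). u' = u \<longrightarrow> v \<in> U) uniformity)"

instance
proof
  fix u v w :: "('a, 'b) proj_tensor" and a c :: real and U :: "('a, 'b) proj_tensor set"
  show "u + v + w = u + (v + w)"
    by transfer (simp add: tensor_cauchy_eq_def tensor_cauchy_add add.assoc)
  show "u + v = v + u"
    by transfer (simp add: tensor_cauchy_eq_def tensor_cauchy_add add.commute)
  show "0 + u = u"
    by transfer (simp add: tensor_cauchy_eq_def)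
  show "- u + u = 0"
    unfolding uminus_proj_tensor_def
    by transfer (simp add: tensor_cauchy_eq_def)
  show "u - v = u + - v"
    by (fact minus_proj_tensor_def)
  show "a *\<^sub>R (u + v) = a *\<^sub>R u + a *\<^sub>R v"
    by transfer (auto simp: tensor_cauchy_eq_def scaleR_add_right
        intro!: tensor_cauchy_add tensor_cauchy_scaleR)
  show "(a + c) *\<^sub>R u = a *\<^sub>R u + c *\<^sub>R u"
    by transfer (auto simp: tensor_cauchy_eq_def scaleR_add_left
        intro!: tensor_cauchy_add tensor_cauchy_scaleR)
  show "a *\<^sub>R c *\<^sub>R u = (a * c) *\<^sub>R u"
    by transfer (auto simp: tensor_cauchy_eq_def intro!: tensor_cauchy_scaleR)
  show "1 *\<^sub>R u = u"
    by transfer (simp add: tensor_cauchy_eq_def)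
  show "dist u v = norm (u - v)"
    by (fact dist_proj_tensor_def)
  show "sgn u = inverse (norm u) *\<^sub>R u"
    by (fact sgn_proj_tensor_def)
  show "(uniformity :: (('a, 'b) proj_tensor \<times> ('a, 'b) proj_tensor) filter) =
     (INF e\<in>{0 <..}. principal {(u, v). dist u v < e})"
    by (fact uniformity_proj_tensor_def)
  show "open U \<longleftrightarrow> (\<forall>u\<in>U. \<forall>\<^sub>F (u', v) in uniformity. u' = u \<longrightarrow> v \<in> U)"
    by (fact open_proj_tensor_def)
  have lim: "(\<lambda>n. proj_norm (s n)) \<longlonglongrightarrow> lim (\<lambda>n. proj_norm (s n))" if "tensor_cauchy_eq s s"
    for s :: "nat \<Rightarrow> ('a, 'b) alg_tensor"
    using that convergent_proj_norm convergent_LIMSEQ_iff unfolding tensor_cauchy_eq_def by blast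
  show "norm u = 0 \<longleftrightarrow> u = 0"
  proof transfer
    fix s :: "nat \<Rightarrow> ('a, 'b) alg_tensor"
    assume s: "tensor_cauchy_eq s s"
    show "lim (\<lambda>n. proj_norm (s n)) = 0 \<longleftrightarrow> tensor_cauchy_eq s (\<lambda>_. 0)"
      using s lim[OF s] by (auto simp: tensor_cauchy_eq_def intro: limI)
  qed
  show "norm (u + v) \<le> norm u + norm v"
  proof transfer
    fix s t :: "nat \<Rightarrow> ('a, 'b) alg_tensor"
    assume s: "tensor_cauchy_eq s s" and t: "tensor_cauchy_eq t t"
    have st: "tensor_cauchy_eq (\<lambda>n. s n + t n) (\<lambda>n. s n + t n)"
      using s t by (simp add: tensor_cauchy_eq_def tensor_cauchy_add)
    show "lim (\<lambda>n. proj_norm (s n + t n)) \<le> lim (\<lambda>n. proj_norm (s n)) + lim (\<lambda>n. proj_norm (t n))"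
      by (rule LIMSEQ_le[OF lim[OF st] tendsto_add[OF lim[OF s] lim[OF t]]])
         (auto simp: proj_norm_triangle)
  qed
  show "norm (a *\<^sub>R u) = \<bar>a\<bar> * norm u"
  proof transfer
    fix a :: real and s :: "nat \<Rightarrow> ('a, 'b) alg_tensor"
    assume s: "tensor_cauchy_eq s s"
    show "lim (\<lambda>n. proj_norm (a *\<^sub>R s n)) = \<bar>a\<bar> * lim (\<lambda>n. proj_norm (s n))"
      unfolding proj_norm_scaleR by (rule limI) (intro tendsto_mult_left lim[OF s])
  qed
qed

end

definition proj_tensor_of_alg ::
  "('a::real_normed_vector, 'b::real_normed_vector) alg_tensor \<Rightarrow> ('a, 'b) proj_tensor" where
  "proj_tensor_of_alg u = abs_proj_tensor (\<lambda>_. u)"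

lemma proj_tensor_of_alg_add: "proj_tensor_of_alg (u + v) = proj_tensor_of_alg u + proj_tensor_of_alg v"
  by (simp add: proj_tensor_of_alg_def plus_proj_tensor.abs_eq tensor_cauchy_eq_def)

lemma proj_tensor_of_alg_scaleR: "proj_tensor_of_alg (c *\<^sub>R u) = c *\<^sub>R proj_tensor_of_alg u"
  by (simp add: proj_tensor_of_alg_def scaleR_proj_tensor.abs_eq tensor_cauchy_eq_def)

lemma proj_tensor_of_alg_zero: "proj_tensor_of_alg 0 = 0"
  by (metis proj_tensor_of_alg_scaleR scaleR_zero_left)

lemma proj_tensor_of_alg_diff: "proj_tensor_of_alg (u - v) = proj_tensor_of_alg u - proj_tensor_of_alg v"
  using proj_tensor_of_alg_add[of "u - v" v] by simp

lemma norm_proj_tensor_of_alg: "norm (proj_tensor_of_alg u) = proj_norm u"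
  by (simp add: proj_tensor_of_alg_def norm_proj_tensor.abs_eq tensor_cauchy_eq_def)

definition is_rep ::
    "(nat \<Rightarrow> ('a::real_normed_vector, 'b::real_normed_vector) alg_tensor) \<Rightarrow>
     ('a, 'b) proj_tensor \<Rightarrow> bool" where
  "is_rep s u \<longleftrightarrow> tensor_cauchy s \<and> u = abs_proj_tensor s"

lemma is_rep_ex: "\<exists>s. is_rep s u"
proof
  show "is_rep (rep_proj_tensor u) u"
    using Quotient3_rep_reflp[OF Quotient3_proj_tensor, of u]
    by (simp add: is_rep_def tensor_cauchy_eq_def Quotient3_abs_rep[OF Quotient3_proj_tensor])
qed

lemma is_rep_tendsto:
  assumes "is_rep s u"
  shows "(\<lambda>n. proj_tensor_of_alg (s n)) \<longlonglongrightarrow> u"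
proof (rule LIMSEQ_I)
  fix e :: real assume "e > 0"
  then obtain N where N: "\<And>m n. m \<ge> N \<Longrightarrow> n \<ge> N \<Longrightarrow> proj_norm (s m - s n) < e / 2"
    using assms unfolding is_rep_def tensor_cauchy_def by (meson half_gt_zero)
  have "norm (proj_tensor_of_alg (s m) - u) < e" if m: "m \<ge> N" for m
  proof -
    have s: "tensor_cauchy s" using assms by (simp add: is_rep_def)
    have d: "tensor_cauchy (\<lambda>n. s m + (- 1) *\<^sub>R s n)"
      by (intro tensor_cauchy_add tensor_cauchy_scaleR s tensor_cauchy_const)
    have "proj_tensor_of_alg (s m) - u = proj_tensor_of_alg (s m) + (- 1) *\<^sub>R u" by simp
    also have "(- 1) *\<^sub>R u = abs_proj_tensor (\<lambda>n. (- 1) *\<^sub>R s n)"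
      using assms scaleR_proj_tensor.abs_eq[of s "- 1"] by (simp add: is_rep_def tensor_cauchy_eq_def)
    also have "proj_tensor_of_alg (s m) + \<dots> = abs_proj_tensor (\<lambda>n. s m + (- 1) *\<^sub>R s n)"
      unfolding proj_tensor_of_alg_def
      by (intro plus_proj_tensor.abs_eq)
         (simp_all only: tensor_cauchy_eq_def tensor_cauchy_const tensor_cauchy_scaleR[OF s], simp_all)
    finally have "norm (proj_tensor_of_alg (s m) - u) = lim (\<lambda>n. proj_norm (s m - s n))"
      using d by (simp add: norm_proj_tensor.abs_eq tensor_cauchy_eq_def)
    moreover have "(\<lambda>n. proj_norm (s m - s n)) \<longlonglongrightarrow> lim (\<lambda>n. proj_norm (s m - s n))"
      using convergent_proj_norm[OF d] by (simp add: convergent_LIMSEQ_iff)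
    then have "lim (\<lambda>n. proj_norm (s m - s n)) \<le> e / 2"
      by (rule LIMSEQ_le_const2) (use N m less_imp_le in blast)
    ultimately show ?thesis using \<open>e > 0\<close> by simp
  qed
  then show "\<exists>N. \<forall>m\<ge>N. norm (proj_tensor_of_alg (s m) - u) < e" by blast
qed

lemma Cauchy_proj_tensor_of_alg: "Cauchy (\<lambda>n. proj_tensor_of_alg (s n)) \<longleftrightarrow> tensor_cauchy s"
  by (simp add: Cauchy_def tensor_cauchy_def dist_norm norm_proj_tensor_of_alg
      flip: proj_tensor_of_alg_diff)

instance proj_tensor :: (real_normed_vector, real_normed_vector) banach
proof
  fix X :: "nat \<Rightarrow> ('a, 'b) proj_tensor"
  assume X: "Cauchy X"
  have "\<exists>a. dist (proj_tensor_of_alg a) (X n) < inverse (real (Suc n))" for n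
  proof -
    obtain s where "is_rep s (X n)" using is_rep_ex by blast
    then have "(\<lambda>k. proj_tensor_of_alg (s k)) \<longlonglongrightarrow> X n" by (rule is_rep_tendsto)
    then have "eventually (\<lambda>k. dist (proj_tensor_of_alg (s k)) (X n) < inverse (real (Suc n))) sequentially"
      by (rule tendstoD) simp
    then show ?thesis using eventually_happens'[OF sequentially_bot] by blast
  qed
  then obtain a where a: "\<And>n. dist (proj_tensor_of_alg (a n)) (X n) < inverse (real (Suc n))"
    by metis
  have null: "(\<lambda>n. proj_tensor_of_alg (a n) - X n) \<longlonglongrightarrow> 0"
    by (rule Lim_null_comparison[OF _ LIMSEQ_inverse_real_of_nat])
       (use a in \<open>auto simp: dist_norm intro!: always_eventually less_imp_le\<close>)
  have "Cauchy (\<lambda>n. proj_tensor_of_alg (a n))"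
  proof (rule metric_CauchyI)
    fix e :: real assume "e > 0"
    then have e: "e / 3 > 0" by simp
    obtain M where M: "\<And>m n. m \<ge> M \<Longrightarrow> n \<ge> M \<Longrightarrow> dist (X m) (X n) < e / 3"
      using metric_CauchyD[OF X e] by blast
    obtain N where N: "\<And>n. n \<ge> N \<Longrightarrow> norm (proj_tensor_of_alg (a n) - X n) < e / 3"
      using LIMSEQ_D[OF null e] by auto
    have "dist (proj_tensor_of_alg (a m)) (proj_tensor_of_alg (a n)) < e"
      if "m \<ge> max M N" "n \<ge> max M N" for m n
    proof -
      have "dist (proj_tensor_of_alg (a m)) (proj_tensor_of_alg (a n))
          \<le> dist (proj_tensor_of_alg (a m)) (X m) + dist (X m) (X n)
            + dist (proj_tensor_of_alg (a n)) (X n)"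
        using dist_triangle[of "proj_tensor_of_alg (a m)" "proj_tensor_of_alg (a n)" "X m"]
          dist_triangle2[of "X m" "proj_tensor_of_alg (a n)" "X n"]
        by linarith
      then show ?thesis
        using M[of m n] N[of m] N[of n] that by (simp add: dist_norm)
    qed
    then show "\<exists>K. \<forall>m\<ge>K. \<forall>n\<ge>K.
        dist (proj_tensor_of_alg (a m)) (proj_tensor_of_alg (a n)) < e" by blast
  qed
  then have "tensor_cauchy a" by (simp add: Cauchy_proj_tensor_of_alg)
  then have "(\<lambda>n. proj_tensor_of_alg (a n)) \<longlonglongrightarrow> abs_proj_tensor a"
    by (intro is_rep_tendsto) (simp add: is_rep_def)
  from tendsto_diff[OF this null] show "convergent X"
    by (auto simp: convergent_def)
qed

definition ptensor :: "'a::real_normed_vector \<Rightarrow> 'b::real_normed_vector \<Rightarrow> ('a, 'b) proj_tensor"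
    (infixr "\<otimes>\<^sub>\<pi>" 70) where
  "x \<otimes>\<^sub>\<pi> y = proj_tensor_of_alg (alg_tensor x y)"

section \<open>Linearisation of bilinear maps\<close>

lemma bounded_bilinear_imp_bilinear:
  assumes "bounded_bilinear B"
  shows "bilinear B"
proof -
  interpret bounded_bilinear B by fact
  show ?thesis
    unfolding bilinear_def
  proof (intro conjI allI)
    show "linear (\<lambda>y. B x y)" for x
      by (rule bounded_linear.linear[OF bounded_linear_right])
    show "linear (\<lambda>x. B x y)" for y
      by (rule bounded_linear.linear[OF bounded_linear_left])
  qed
qed

lemma formal_sum_linear:
  assumes "linear f"
  shows "f (formal_sum B us) = formal_sum (\<lambda>x y. f (B x y)) us"
proof (induction us)
  case Nil
  show ?case by (simp add: linear_0[OF assms])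
next
  case (Cons p us)
  then show ?case by (cases p) (simp add: linear_add[OF assms])
qed

lemma tensor_eq_formal_sum:
  fixes B :: "'a::real_vector \<Rightarrow> 'b::real_vector \<Rightarrow> 'c::real_vector"
  assumes eq: "tensor_eq us vs" and B: "bilinear B"
  shows "formal_sum B us = formal_sum B vs"
proof (rule ccontr)
  define d where "d = formal_sum B us - formal_sum B vs"
  assume "formal_sum B us \<noteq> formal_sum B vs"
  then have "independent {d}" by (simp add: d_def)
  then obtain f :: "'c \<Rightarrow> real" where f: "linear f" "f d = 1"
    using linear_independent_extend[of "{d}" "\<lambda>_. 1"] by auto
  have "bilinear (\<lambda>x y. f (B x y))"
    using B f(1) unfolding bilinear_def linear_iff by simp
  then have "formal_sum (\<lambda>x y. f (B x y)) us = formal_sum (\<lambda>x y. f (B x y)) vs"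
    using eq by (simp add: tensor_eq_def)
  then have "f d = 0"
    by (simp add: d_def linear_diff[OF f(1)] formal_sum_linear[OF f(1)])
  with f(2) show False by simp
qed

definition alg_linearisation ::
    "('a::real_vector \<Rightarrow> 'b::real_vector \<Rightarrow> 'c::real_vector) \<Rightarrow> ('a, 'b) alg_tensor \<Rightarrow> 'c" where
  "alg_linearisation B u = formal_sum B (rep_alg_tensor u)"

lemma alg_linearisation_abs:
  assumes "bilinear B"
  shows "alg_linearisation B (abs_alg_tensor us) = formal_sum B us"
  unfolding alg_linearisation_def
  by (rule tensor_eq_formal_sum[OF _ assms])
     (rule Quotient3_rep_abs[OF Quotient3_alg_tensor], simp add: tensor_eq_def)

lemma linear_alg_linearisation:
  assumes "bilinear B"
  shows "linear (alg_linearisation B)"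
proof (rule linearI)
  fix u v :: "('a, 'b) alg_tensor" and c :: real
  obtain us vs where uv: "u = abs_alg_tensor us" "v = abs_alg_tensor vs"
    using alg_tensor_rep_ex by metis
  show "alg_linearisation B (u + v) = alg_linearisation B u + alg_linearisation B v"
    by (simp add: uv plus_alg_tensor.abs_eq alg_linearisation_abs[OF assms])
  show "alg_linearisation B (c *\<^sub>R u) = c *\<^sub>R alg_linearisation B u"
    by (simp add: uv scaleR_alg_tensor.abs_eq alg_linearisation_abs[OF assms]
        formal_sum_scale[OF assms])
qed

lemma norm_alg_linearisation_le:
  assumes "bilinear B" and K: "K > 0" "\<And>x y. norm (B x y) \<le> norm x * norm y * K"
  shows "norm (alg_linearisation B u) \<le> K * proj_norm u"
proof -
  have "norm (formal_sum B us) \<le> K * formal_sum (\<lambda>x y. norm x * norm y) us" for us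
  proof (induction us)
    case (Cons p us)
    obtain x y where p: "p = (x, y)" by (cases p)
    show ?case
      using Cons K(2)[of x y] norm_triangle_ineq[of "B x y" "formal_sum B us"]
      by (simp add: p algebra_simps)
  qed simp
  then have "norm (alg_linearisation B u) / K \<le> proj_norm u"
    using K(1) alg_linearisation_abs[OF assms(1)]
    by (intro proj_norm_greatest) (auto simp: field_simps)
  then show ?thesis using K(1) by (simp add: field_simps)
qed

lemma linearisation_ex:
  fixes B :: "'a::real_normed_vector \<Rightarrow> 'b::real_normed_vector \<Rightarrow> 'c::banach"
  assumes B: "bounded_bilinear B"
  shows "\<exists>T :: ('a, 'b) proj_tensor \<Rightarrow>\<^sub>L 'c. \<forall>x y. blinfun_apply T (x \<otimes>\<^sub>\<pi> y) = B x y"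
proof -
  have bil: "bilinear B" by (rule bounded_bilinear_imp_bilinear[OF B])
  obtain K where K: "K > 0" "\<And>x y. norm (B x y) \<le> norm x * norm y * K"
    using bounded_bilinear.pos_bounded[OF B] by blast
  let ?L = "alg_linearisation B"
  have L: "linear ?L" by (rule linear_alg_linearisation[OF bil])
  have Lle: "norm (?L u) \<le> K * proj_norm u" for u
    by (rule norm_alg_linearisation_le[OF bil K])
  have conv: "convergent (\<lambda>n. ?L (s n))" if s: "is_rep s u" for s u
  proof -
    have "Cauchy (\<lambda>n. ?L (s n))"
      unfolding Cauchy_def dist_norm
    proof (intro allI impI)
      fix e :: real assume "e > 0"
      then have "e / K > 0" using K by simp
      then obtain N where N: "\<And>m n. m \<ge> N \<Longrightarrow> n \<ge> N \<Longrightarrow> proj_norm (s m - s n) < e / K"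
        using s unfolding is_rep_def tensor_cauchy_def by blast
      have "norm (?L (s m) - ?L (s n)) < e" if "m \<ge> N" "n \<ge> N" for m n
        using N[OF that] Lle[of "s m - s n"] K by (simp add: linear_diff[OF L] field_simps)
      then show "\<exists>N. \<forall>m\<ge>N. \<forall>n\<ge>N. norm (?L (s m) - ?L (s n)) < e" by blast
    qed
    then show ?thesis by (rule Cauchy_convergent)
  qed
  have "\<exists>l. \<forall>s. is_rep s u \<longrightarrow> (\<lambda>n. ?L (s n)) \<longlonglongrightarrow> l" for u
  proof -
    obtain r where r: "is_rep r u" using is_rep_ex by blast
    obtain l where l: "(\<lambda>n. ?L (r n)) \<longlonglongrightarrow> l" using conv[OF r] by (auto simp: convergent_def)
    have "(\<lambda>n. ?L (s n)) \<longlonglongrightarrow> l" if s: "is_rep s u" for s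
    proof -
      have "(\<lambda>n. norm (proj_tensor_of_alg (s n - r n))) \<longlonglongrightarrow> 0"
        using tendsto_norm[OF tendsto_diff[OF is_rep_tendsto[OF s] is_rep_tendsto[OF r]]]
        by (simp add: proj_tensor_of_alg_diff)
      then have "(\<lambda>n. K * proj_norm (s n - r n)) \<longlonglongrightarrow> 0"
        by (intro tendsto_mult_right_zero) (simp add: norm_proj_tensor_of_alg)
      then have "(\<lambda>n. ?L (s n - r n)) \<longlonglongrightarrow> 0"
        by (rule Lim_null_comparison[rotated]) (simp add: Lle)
      from tendsto_add[OF this l] show ?thesis by (simp add: linear_diff[OF L])
    qed
    then show ?thesis by blast
  qed
  then obtain T where T: "\<And>u s. is_rep s u \<Longrightarrow> (\<lambda>n. ?L (s n)) \<longlonglongrightarrow> T u" by metis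
  have "bounded_linear T"
  proof (rule bounded_linear_intro)
    fix u v :: "('a, 'b) proj_tensor" and c :: real
    obtain s t where s: "is_rep s u" and t: "is_rep t v" using is_rep_ex by metis
    have "is_rep (\<lambda>n. s n + t n) (u + v)"
      using s t by (simp add: is_rep_def plus_proj_tensor.abs_eq tensor_cauchy_eq_def tensor_cauchy_add)
    from T[OF this] have "(\<lambda>n. ?L (s n) + ?L (t n)) \<longlonglongrightarrow> T (u + v)"
      by (simp add: linear_add[OF L])
    then show "T (u + v) = T u + T v"
      using tendsto_add[OF T[OF s] T[OF t]] LIMSEQ_unique by blast
    have "is_rep (\<lambda>n. c *\<^sub>R s n) (c *\<^sub>R u)"
      using s by (simp add: is_rep_def scaleR_proj_tensor.abs_eq tensor_cauchy_eq_def tensor_cauchy_scaleR)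
    from T[OF this] have "(\<lambda>n. c *\<^sub>R ?L (s n)) \<longlonglongrightarrow> T (c *\<^sub>R u)"
      by (simp add: linear_scale[OF L])
    then show "T (c *\<^sub>R u) = c *\<^sub>R T u"
      using tendsto_scaleR[OF tendsto_const T[OF s]] LIMSEQ_unique by blast
    have "(\<lambda>n. norm (proj_tensor_of_alg (s n)) * K) \<longlonglongrightarrow> norm u * K"
      by (intro tendsto_intros is_rep_tendsto s)
    then show "norm (T u) \<le> norm u * K"
      by (rule LIMSEQ_le[OF tendsto_norm[OF T[OF s]]])
         (use Lle in \<open>auto simp: norm_proj_tensor_of_alg mult.commute\<close>)
  qed
  moreover have "T (x \<otimes>\<^sub>\<pi> y) = B x y" for x y
  proof -
    have "is_rep (\<lambda>_. alg_tensor x y) (x \<otimes>\<^sub>\<pi> y)"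
      by (simp add: is_rep_def ptensor_def proj_tensor_of_alg_def)
    from T[OF this] have "T (x \<otimes>\<^sub>\<pi> y) = ?L (alg_tensor x y)"
      using LIMSEQ_unique tendsto_const by blast
    then show ?thesis by (simp add: alg_tensor.abs_eq alg_linearisation_abs[OF bil])
  qed
  ultimately show ?thesis
    by (intro exI[of _ "Blinfun T"]) (simp add: bounded_linear_Blinfun_apply)
qed

lemma linearisation_unique:
  fixes T T' :: "('a::real_normed_vector, 'b::real_normed_vector) proj_tensor \<Rightarrow>\<^sub>L 'c::real_normed_vector"
  assumes eq: "\<And>x y. blinfun_apply T (x \<otimes>\<^sub>\<pi> y) = blinfun_apply T' (x \<otimes>\<^sub>\<pi> y)"
  shows "T = T'"
proof (rule blinfun_eqI)
  fix u :: "('a, 'b) proj_tensor"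
  have list: "T (proj_tensor_of_alg (abs_alg_tensor us)) = T' (proj_tensor_of_alg (abs_alg_tensor us))"
    for us :: "('a \<times> 'b) list"
  proof (induction us)
    case Nil
    show ?case
      by (simp add: proj_tensor_of_alg_zero flip: zero_alg_tensor.abs_eq)
  next
    case (Cons p us)
    obtain x y where p: "p = (x, y)" by (cases p)
    have "abs_alg_tensor (p # us) = alg_tensor x y + abs_alg_tensor us"
      by (simp add: p alg_tensor.abs_eq plus_alg_tensor.abs_eq)
    then show ?case
      using Cons eq[of x y] by (simp add: proj_tensor_of_alg_add blinfun.add_right ptensor_def)
  qed
  have alg: "T (proj_tensor_of_alg v) = T' (proj_tensor_of_alg v)" for v :: "('a, 'b) alg_tensor"
  proof -
    obtain vs where "abs_alg_tensor vs = v" using alg_tensor_rep_ex by blast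
    then show ?thesis using list[of vs] by simp
  qed
  obtain s :: "nat \<Rightarrow> ('a, 'b) alg_tensor" where s: "is_rep s u"
    using is_rep_ex by blast
  have "(\<lambda>n. T (proj_tensor_of_alg (s n))) \<longlonglongrightarrow> T u"
    by (rule blinfun.tendsto[OF tendsto_const is_rep_tendsto[OF s]])
  moreover have "(\<lambda>n. T (proj_tensor_of_alg (s n))) \<longlonglongrightarrow> T' u"
    unfolding alg by (rule blinfun.tendsto[OF tendsto_const is_rep_tendsto[OF s]])
  ultimately show "T u = T' u" by (rule LIMSEQ_unique)
qed

definition linearisation ::
    "('a::real_normed_vector \<Rightarrow> 'b::real_normed_vector \<Rightarrow> 'c::banach) \<Rightarrow>
     ('a, 'b) proj_tensor \<Rightarrow>\<^sub>L 'c" where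
  "linearisation B = (THE T. \<forall>x y. blinfun_apply T (x \<otimes>\<^sub>\<pi> y) = B x y)"

lemma linearisation_apply [simp]:
  assumes "bounded_bilinear B"
  shows "blinfun_apply (linearisation B) (x \<otimes>\<^sub>\<pi> y) = B x y"
proof -
  obtain T where T: "\<forall>x y. blinfun_apply T (x \<otimes>\<^sub>\<pi> y) = B x y"
    using linearisation_ex[OF assms] by blast
  have "\<exists>!T. \<forall>x y. blinfun_apply T (x \<otimes>\<^sub>\<pi> y) = B x y"
  proof (rule ex1I[of _ T])
    fix T' assume "\<forall>x y. blinfun_apply T' (x \<otimes>\<^sub>\<pi> y) = B x y"
    with T show "T' = T" by (intro linearisation_unique) simp
  qed (rule T)
  from theI'[OF this] show ?thesis unfolding linearisation_def by blast
qed


section \<open>The Daugavet property, norming maps and slices\<close>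

definition daugavet_property :: "'z::real_normed_vector itself \<Rightarrow> bool" where
  "daugavet_property _ \<longleftrightarrow>
     (\<forall>Q :: 'z \<Rightarrow>\<^sub>L 'z. dim (range (blinfun_apply Q)) = 1 \<longrightarrow> norm (id_blinfun + Q) = 1 + norm Q)"

definition bilinear_norm ::
    "('x::real_normed_vector \<Rightarrow> 'y::real_normed_vector \<Rightarrow> 'z::real_normed_vector) \<Rightarrow> real" where
  "bilinear_norm B = (SUP (x, y)\<in>cball 0 1 \<times> cball 0 1. norm (B x y))"

definition norming_bilinear ::
    "('x::real_normed_vector \<Rightarrow> 'y::real_normed_vector \<Rightarrow> 'z::real_normed_vector) \<Rightarrow> bool" where
  "norming_bilinear B \<longleftrightarrow>
     bounded_bilinear B \<and> (\<lambda>(x, y). B x y) ` (ball 0 1 \<times> ball 0 1) = ball 0 1"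

definition bilinear_slice ::
    "('x::real_normed_vector \<Rightarrow> 'y::real_normed_vector \<Rightarrow> real) \<Rightarrow> real \<Rightarrow> ('x \<times> 'y) set" where
  "bilinear_slice b \<epsilon> = {(x, y). x \<in> cball 0 1 \<and> y \<in> cball 0 1 \<and> b x y \<ge> 1 - \<epsilon>}"

definition bilinear_pairing ::
    "('x \<Rightarrow> 'y \<Rightarrow> 'z::real_normed_vector) \<Rightarrow> ('z \<Rightarrow>\<^sub>L real) \<Rightarrow> 'x \<Rightarrow> 'y \<Rightarrow> real" where
  "bilinear_pairing B z' = (\<lambda>x y. blinfun_apply z' (B x y))"

definition normalized_pairing ::
    "('x::real_normed_vector \<Rightarrow> 'y::real_normed_vector \<Rightarrow> 'z::real_normed_vector) \<Rightarrow>
     ('z \<Rightarrow>\<^sub>L real) \<Rightarrow> 'x \<Rightarrow> 'y \<Rightarrow> real" where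
  "normalized_pairing B z' =
     (\<lambda>x y. bilinear_pairing B z' x y / bilinear_norm (bilinear_pairing B z'))"

definition bilinear_slices ::
    "('x::real_normed_vector \<Rightarrow> 'y::real_normed_vector \<Rightarrow> 'z::real_normed_vector) \<Rightarrow>
     ('x \<times> 'y) set set" where
  "bilinear_slices B =
     {bilinear_slice (normalized_pairing B z') \<epsilon> | z' \<epsilon>.
        0 < \<epsilon> \<and> \<epsilon> < 1 \<and> norm z' = 1 \<and> bilinear_norm (bilinear_pairing B z') \<noteq> 0}"

definition functional_slice :: "('e::real_normed_vector \<Rightarrow>\<^sub>L real) \<Rightarrow> real \<Rightarrow> 'e set" where
  "functional_slice e' \<epsilon> = {e \<in> cball 0 1. blinfun_apply e' e \<ge> 1 - \<epsilon>}"

definition blinfun_adjoint ::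
    "('e::real_normed_vector \<Rightarrow>\<^sub>L 'z::real_normed_vector) \<Rightarrow> ('z \<Rightarrow>\<^sub>L real) \<Rightarrow> 'e \<Rightarrow>\<^sub>L real" where
  "blinfun_adjoint T z' = z' o\<^sub>L T"

definition operator_slices ::
    "('e::real_normed_vector \<Rightarrow>\<^sub>L 'z::real_normed_vector) \<Rightarrow> 'e set set" where
  "operator_slices T =
     {functional_slice (blinfun_adjoint T z' /\<^sub>R norm (blinfun_adjoint T z')) \<epsilon> | z' \<epsilon>.
        0 < \<epsilon> \<and> \<epsilon> < 1 \<and> blinfun_adjoint T z' \<noteq> 0}"

definition slices_le ::
    "('x::real_normed_vector, 'y::real_normed_vector) proj_tensor set set \<Rightarrow>
     ('x \<times> 'y) set set \<Rightarrow> bool" where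
  "slices_le \<S> \<S>' \<longleftrightarrow> (\<forall>S\<in>\<S>. \<exists>S1\<in>\<S>'. (\<lambda>(x, y). x \<otimes>\<^sub>\<pi> y) ` S1 \<subseteq> S)"


section \<open>Weak compactness\<close>

definition weak_topology :: "'z::real_normed_vector topology" where
  "weak_topology =
     topology_generated_by {blinfun_apply f -` U | (f :: 'z \<Rightarrow>\<^sub>L real) U. open U}"

definition weakly_compact_operator ::
    "('e::real_normed_vector \<Rightarrow>\<^sub>L 'z::real_normed_vector) \<Rightarrow> bool" where
  "weakly_compact_operator T \<longleftrightarrow>
     compactin weak_topology (weak_topology closure_of (blinfun_apply T ` cball 0 1))"

end

(*
  By the Daugavet property every slice of B0 contains a slice S' on which one functional h of norm
  at most one is almost 1 at all values of B0 and almost |z| at a prescribed vector z.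
  With z = |B| z0 this gives (1) at once.

  For (2), start with a slice on which k o B is almost |B| for a functional k of norm at most one.
  Choose nested slices S_n and points (x_n, y_n) in S_n such that S_n has such an h for every z in
  the convex hull of v_i = B(x_i, y_i), i < n. The sequence (v_n) has a weak cluster point w, and by
  Mazur w is a norm limit of convex combinations of the v_n and of those of every tail. So p in the
  hull of v_0, ..., v_(N-1) and q in the hull of (v_m), m >= N, are close to each other, and the
  functional h belonging to S_N and p satisfies h(q) > |B| - c; hence h(v_m) > |B| - c for some
  m >= N, while h(B0(x_m, y_m)) > 1 - c. No dentability of weakly compact sets is needed.
*)

theory Submission
  imports Defs
begin

section \<open>Sublinear functionals and the Hahn-Banach theorem\<close>

definition sublinear :: "('a::real_vector \<Rightarrow> real) \<Rightarrow> bool" where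
  "sublinear p \<longleftrightarrow> (\<forall>x y. p (x + y) \<le> p x + p y) \<and> (\<forall>c\<ge>0. \<forall>x. p (c *\<^sub>R x) = c * p x)"

lemma sublinear_add: "sublinear p \<Longrightarrow> p (x + y) \<le> p x + p y"
  and sublinear_scaleR: "sublinear p \<Longrightarrow> 0 \<le> c \<Longrightarrow> p (c *\<^sub>R x) = c * p x"
  by (auto simp: sublinear_def)

lemma sublinear_uminus_ge: "sublinear p \<Longrightarrow> - p (- x) \<le> p x"
  using sublinear_add[of p x "- x"] sublinear_scaleR[of p 0 0] by simp

text \<open>Applying \<open>scale\<close> with \<open>inverse c\<close> at the point
  \<open>c *\<^sub>R x\<close> turns the inequality into an equality.\<close>

lemma sublinearI:
  assumes add: "\<And>x y. p (x + y) \<le> p x + p y"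
    and scale: "\<And>c x. 0 < c \<Longrightarrow> p (c *\<^sub>R x) \<le> c * p x"
    and zero: "p 0 = 0"
  shows "sublinear p"
  unfolding sublinear_def
proof (intro conjI allI impI)
  fix c :: real and x
  assume "0 \<le> c"
  show "p (c *\<^sub>R x) = c * p x"
  proof (cases "c = 0")
    case False
    with \<open>0 \<le> c\<close> have c: "0 < c" by simp
    then have "p x \<le> inverse c * p (c *\<^sub>R x)"
      using scale[of "inverse c" "c *\<^sub>R x"] by simp
    then have "c * p x \<le> p (c *\<^sub>R x)"
      using c by (simp add: field_simps)
    with scale[OF c, of x] show ?thesis by simp
  qed (simp add: zero)
qed (rule add)

text \<open>Near-minimisers at \<open>x\<close> and at \<open>y\<close> are comparable, so the
  smaller one serves both points, and its subadditivity bounds the infimum at \<open>x + y\<close>.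
  The minorant \<open>b\<close> keeps the infima finite.\<close>

lemma sublinear_Inf_chain:
  assumes ne: "C \<noteq> {}" and sub: "\<And>q. q \<in> C \<Longrightarrow> sublinear q"
    and bdd: "\<And>q x. q \<in> C \<Longrightarrow> b x \<le> q x"
    and chain: "\<And>q r. q \<in> C \<Longrightarrow> r \<in> C \<Longrightarrow> q \<le> r \<or> r \<le> q"
  shows "sublinear (\<lambda>x. INF q\<in>C. q x)"
proof (rule sublinearI)
  have bb: "bdd_below ((\<lambda>q. q x) ` C)" for x
    using bdd by (intro bdd_belowI2[of _ "b x"])
  show "(INF q\<in>C. q (x + y)) \<le> (INF q\<in>C. q x) + (INF q\<in>C. q y)" for x y
  proof (rule field_le_epsilon)
    fix e :: real assume "0 < e"
    then obtain q r where q: "q \<in> C" "q x < (INF q\<in>C. q x) + e / 2"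
      and r: "r \<in> C" "r y < (INF q\<in>C. q y) + e / 2"
      using cINF_less_iff[OF ne bb[of x], of "(INF q\<in>C. q x) + e / 2"]
        cINF_less_iff[OF ne bb[of y], of "(INF q\<in>C. q y) + e / 2"] by auto
    obtain s where s: "s \<in> C" "s \<le> q" "s \<le> r"
      using chain[OF q(1) r(1)] q(1) r(1) by auto
    have "(INF q\<in>C. q (x + y)) \<le> s (x + y)"
      by (rule cINF_lower[OF bb s(1)])
    also have "\<dots> \<le> s x + s y"
      by (rule sublinear_add[OF sub[OF s(1)]])
    also have "\<dots> \<le> q x + r y"
      using s by (intro add_mono) (auto simp: le_fun_def)
    finally show "(INF q\<in>C. q (x + y)) \<le> (INF q\<in>C. q x) + (INF q\<in>C. q y) + e"
      using q r by simp
  qed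
  show "(INF q\<in>C. q (c *\<^sub>R x)) \<le> c * (INF q\<in>C. q x)" if "0 < c" for c x
  proof -
    have "(INF q\<in>C. q (c *\<^sub>R x)) / c \<le> q x" if "q \<in> C" for q
      using cINF_lower[OF bb[of "c *\<^sub>R x"] that] \<open>0 < c\<close> sublinear_scaleR[OF sub[OF that], of c x]
      by (simp add: field_simps)
    then have "(INF q\<in>C. q (c *\<^sub>R x)) / c \<le> (INF q\<in>C. q x)"
      by (intro cINF_greatest[OF ne])
    then show ?thesis using that by (simp add: field_simps)
  qed
  have "q 0 = 0" if "q \<in> C" for q
    using sublinear_scaleR[OF sub[OF that], of 0 0] by simp
  then have "(\<lambda>q. q 0) ` C = {0}"
    using ne by force
  then show "(INF q\<in>C. q 0) = 0" by simp
qed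

text \<open>The witness is the infimum of \<open>q (x + t *\<^sub>R y) - t * q y\<close> over
  \<open>t \<ge> 0\<close>: the parameters add up under subadditivity, \<open>t = 0\<close> gives
  \<open>q' \<le> q\<close>, and \<open>t = 1\<close> gives the last bound, which for a minimal
  \<open>q\<close> is superadditivity.\<close>

lemma sublinear_shift:
  assumes q: "sublinear q"
  obtains q' where "sublinear q'" "q' \<le> q" "\<And>x. q' x \<le> q (x + y) - q y"
proof
  let ?g = "\<lambda>x t. q (x + t *\<^sub>R y) - t * q y"
  define q' where "q' = (\<lambda>x. INF t\<in>{0..}. ?g x t)"
  have lb: "- q (- x) \<le> ?g x t" if "0 \<le> t" for x t
    using sublinear_add[OF q, of "x + t *\<^sub>R y" "- x"] sublinear_scaleR[OF q that, of y] by simp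
  have bb: "bdd_below (?g x ` {0..})" for x
    using lb by (intro bdd_belowI2[of _ "- q (- x)"]) auto
  have le: "q' x \<le> ?g x t" if "0 \<le> t" for x t
    unfolding q'_def using that by (intro cINF_lower[OF bb]) auto
  have ne: "{0::real..} \<noteq> {}" by auto
  show "q' \<le> q"
    using le[of 0] by (auto simp: le_fun_def)
  show "q' x \<le> q (x + y) - q y" for x
    using le[of 1 x] by simp
  show "sublinear q'"
  proof (rule sublinearI)
    fix x z
    show "q' (x + z) \<le> q' x + q' z"
    proof (rule field_le_epsilon)
      fix e :: real assume "0 < e"
      then obtain s t where s: "0 \<le> s" "?g x s < q' x + e / 2"
        and t: "0 \<le> t" "?g z t < q' z + e / 2"
        using cINF_less_iff[OF ne bb[of x], of "q' x + e / 2"]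
          cINF_less_iff[OF ne bb[of z], of "q' z + e / 2"] by (auto simp: q'_def)
      have "q' (x + z) \<le> ?g (x + z) (s + t)"
        using s t by (intro le) auto
      also have "\<dots> \<le> ?g x s + ?g z t"
        using sublinear_add[OF q, of "x + s *\<^sub>R y" "z + t *\<^sub>R y"] by (simp add: algebra_simps)
      finally show "q' (x + z) \<le> q' x + q' z + e" using s t by simp
    qed
  next
    fix c :: real and x assume c: "0 < c"
    have "q' (c *\<^sub>R x) / c \<le> ?g x t" if "0 \<le> t" for t
    proof -
      have "q' (c *\<^sub>R x) \<le> ?g (c *\<^sub>R x) (c * t)"
        using that c by (intro le) auto
      also have "\<dots> = c * ?g x t"
        using sublinear_scaleR[OF q, of c "x + t *\<^sub>R y"] c by (simp add: algebra_simps)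
      finally show ?thesis using c by (simp add: field_simps)
    qed
    then have "q' (c *\<^sub>R x) / c \<le> q' x"
      unfolding q'_def[THEN fun_cong, of x] by (intro cINF_greatest[OF ne]) auto
    then show "q' (c *\<^sub>R x) \<le> c * q' x" using c by (simp add: field_simps)
  next
    have "?g 0 t = 0" if "0 \<le> t" for t
      using sublinear_scaleR[OF q that, of y] by simp
    then show "q' 0 = 0" by (simp add: q'_def)
  qed
qed

text \<open>A minimal sublinear functional below \<open>p\<close> cannot be lowered by \<open>sublinear_shift\<close> and is
  therefore additive.\<close>

theorem Hahn_Banach_sublinear:
  fixes p :: "'a::real_vector \<Rightarrow> real"
  assumes p: "sublinear p"
  obtains f where "linear f" "\<And>x. f x \<le> p x"
proof -
  \<comment> \<open>The order is reversed for Zorn's lemma: a maximal element is a minimal sublinear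
    functional, and chains need lower bounds.\<close>
  let ?A = "{q. sublinear q \<and> q \<le> p}" and ?P = "\<lambda>q r :: 'a \<Rightarrow> real. r \<le> q"
  have "\<exists>m\<in>?A. \<forall>a\<in>?A. ?P m a \<longrightarrow> a = m"
  proof (rule predicate_Zorn)
    show "partial_order_on ?A (relation_of ?P ?A)"
      by (rule partial_order_on_relation_ofI) auto
    fix C assume "C \<in> Chains (relation_of ?P ?A)"
    then have C: "\<And>q. q \<in> C \<Longrightarrow> sublinear q \<and> q \<le> p"
      and chain: "\<And>q r. q \<in> C \<Longrightarrow> r \<in> C \<Longrightarrow> q \<le> r \<or> r \<le> q"
      unfolding Chains_def relation_of_def by auto
    show "\<exists>u\<in>?A. \<forall>a\<in>C. ?P a u"
    proof (cases "C = {}")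
      case True
      then show ?thesis using p by auto
    next
      case False
      \<comment> \<open>From \<open>- p (- x) \<le> - q (- x) \<le> q x\<close>, a bound common to
        the whole chain.\<close>
      have bdd: "- p (- x) \<le> q x" if "q \<in> C" for q x
        using sublinear_uminus_ge[of q x] C[OF that] le_funD[of q p "- x"] by simp
      have lower: "(\<lambda>x. INF q\<in>C. q x) \<le> q" if "q \<in> C" for q
        unfolding le_fun_def
        using bdd that by (intro allI cINF_lower bdd_belowI2[of _ "- p (- _)"])
      have "sublinear (\<lambda>x. INF q\<in>C. q x)"
        by (rule sublinear_Inf_chain[OF False, of "\<lambda>x. - p (- x)"]) (use C bdd chain in auto)
      moreover have "(\<lambda>x. INF q\<in>C. q x) \<le> p"
        using lower C False by (meson all_not_in_conv order_trans)
      ultimately show ?thesis using lower by blast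
    qed
  qed
  then obtain m where m: "sublinear m" "m \<le> p"
    and min: "\<And>q. sublinear q \<Longrightarrow> q \<le> m \<Longrightarrow> q = m"
    by (metis (mono_tags, lifting) mem_Collect_eq order_trans)
  have add: "m (x + y) = m x + m y" for x y
  proof -
    obtain q where "sublinear q" "q \<le> m" "q x \<le> m (x + y) - m y"
      using sublinear_shift[OF m(1), of y] by metis
    then show ?thesis
      using min[of q] sublinear_add[OF m(1), of x y] by simp
  qed
  have neg: "m (- x) = - m x" for x
    using add[of x "- x"] sublinear_scaleR[OF m(1), of 0 0] by simp
  have "m (c *\<^sub>R x) = c * m x" for c x
    using sublinear_scaleR[OF m(1), of "\<bar>c\<bar>" x] neg[of "\<bar>c\<bar> *\<^sub>R x"]
    by (cases "0 \<le> c") auto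
  then have "linear m"
    using add by (intro linearI) auto
  then show ?thesis
    using that m(2) by (auto simp: le_fun_def)
qed

section \<open>Separation of a point from a convex set, norming functionals and almost norming
  vectors\<close>

text \<open>Hahn-Banach is applied to \<open>p x\<close>, the infimum of
  \<open>norm (x + t *\<^sub>R (w - c)) - t * d\<close> over \<open>t \<ge> 0\<close> and
  \<open>c \<in> C\<close>; the distance hypothesis keeps it finite. For \<open>f \<le> p\<close>,
  the choice \<open>t = 0\<close> bounds \<open>f\<close> by the norm, and \<open>t = 1\<close> at
  the point \<open>- (w - c)\<close> gives the separation.\<close>

lemma separate_point_convex:
  fixes w :: "'a::real_normed_vector"
  assumes C: "convex C" "C \<noteq> {}" and d: "\<And>c. c \<in> C \<Longrightarrow> d \<le> norm (w - c)"
  obtains f :: "'a \<Rightarrow>\<^sub>L real" where "norm f \<le> 1" "\<And>c. c \<in> C \<Longrightarrow> d \<le> f w - f c"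
proof -
  let ?I = "{0::real..} \<times> C" and ?g = "\<lambda>x (t, c). norm (x + t *\<^sub>R (w - c)) - t * d"
  define p where "p = (\<lambda>x. INF i\<in>?I. ?g x i)"
  obtain c0 where c0: "c0 \<in> C" using C by blast
  then have "(0, c0) \<in> ?I" by simp
  then have ne: "?I \<noteq> {}" by blast
  have lb: "- norm x \<le> ?g x (t, c)" if "0 \<le> t" "c \<in> C" for x t c
  proof -
    have "t * d \<le> norm (t *\<^sub>R (w - c))"
      using that d by (simp add: mult_left_mono)
    then show ?thesis
      using norm_triangle_ineq4[of "x + t *\<^sub>R (w - c)" x] by simp
  qed
  have bb: "bdd_below (?g x ` ?I)" for x
    using lb by (intro bdd_belowI2[of _ "- norm x"]) auto
  have le: "p x \<le> norm (x + t *\<^sub>R (w - c)) - t * d" if "0 \<le> t" "c \<in> C" for x t c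
    using cINF_lower[OF bb[of x], of "(t, c)"] that by (auto simp: p_def)
  have "sublinear p"
  proof (rule sublinearI)
    fix x y
    show "p (x + y) \<le> p x + p y"
    proof (rule field_le_epsilon)
      fix e :: real assume "0 < e"
      then obtain s a t b where s: "0 \<le> s" "a \<in> C" "?g x (s, a) < p x + e / 2"
        and t: "0 \<le> t" "b \<in> C" "?g y (t, b) < p y + e / 2"
        using cINF_less_iff[OF ne bb[of x], of "p x + e / 2"]
          cINF_less_iff[OF ne bb[of y], of "p y + e / 2"] by (auto simp: p_def)
      \<comment> \<open>Convexity enters here: the points \<open>a\<close> and \<open>b\<close>
        merge into one with weights \<open>s / (s + t)\<close> and \<open>t / (s + t)\<close>; if
        both parameters vanish, any point of \<open>C\<close> serves.\<close>
      obtain c where c: "c \<in> C" "(s + t) *\<^sub>R c = s *\<^sub>R a + t *\<^sub>R b"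
      proof (cases "s + t = 0")
        case True
        then have "s = 0" "t = 0" using s(1) t(1) by auto
        then show ?thesis using that[OF s(2)] by simp
      next
        case False
        then have "0 < s + t" using s t by simp
        then have "(s / (s + t)) *\<^sub>R a + (t / (s + t)) *\<^sub>R b \<in> C"
          using s t \<open>0 < s + t\<close> by (intro convexD[OF C(1)]) (simp_all flip: add_divide_distrib)
        then show ?thesis
          by (rule that) (use \<open>0 < s + t\<close> in \<open>simp add: scaleR_add_right\<close>)
      qed
      have "p (x + y) \<le> norm (x + y + (s + t) *\<^sub>R (w - c)) - (s + t) * d"
        using s t c by (intro le) auto
      also have "x + y + (s + t) *\<^sub>R (w - c) = (x + s *\<^sub>R (w - a)) + (y + t *\<^sub>R (w - b))"
        using c(2) by (simp add: algebra_simps)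
      also have "norm \<dots> - (s + t) * d \<le> ?g x (s, a) + ?g y (t, b)"
        using norm_triangle_ineq[of "x + s *\<^sub>R (w - a)" "y + t *\<^sub>R (w - b)"]
        by (simp add: algebra_simps)
      finally show "p (x + y) \<le> p x + p y + e" using s t by simp
    qed
  next
    fix k :: real and x assume k: "0 < k"
    have "p (k *\<^sub>R x) / k \<le> ?g x (t, c)" if "0 \<le> t" "c \<in> C" for t c
    proof -
      have "p (k *\<^sub>R x) \<le> norm (k *\<^sub>R x + (k * t) *\<^sub>R (w - c)) - (k * t) * d"
        using that k by (intro le) auto
      also have "k *\<^sub>R x + (k * t) *\<^sub>R (w - c) = k *\<^sub>R (x + t *\<^sub>R (w - c))"
        by (simp add: scaleR_add_right)
      also have "norm \<dots> - (k * t) * d = k * ?g x (t, c)"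
        using k by (simp only: norm_scaleR) (simp add: right_diff_distrib)
      finally show ?thesis using k by (simp add: field_simps)
    qed
    then have "p (k *\<^sub>R x) / k \<le> p x"
      unfolding p_def[THEN fun_cong, of x] by (intro cINF_greatest[OF ne]) auto
    then show "p (k *\<^sub>R x) \<le> k * p x" using k by (simp add: field_simps)
  next
    have "p 0 \<le> 0" using le[of 0 _ 0] C by auto
    moreover have "0 \<le> p 0"
      unfolding p_def by (intro cINF_greatest[OF ne]) (use lb[of _ _ 0] in auto)
    ultimately show "p 0 = 0" by simp
  qed
  then obtain f where f: "linear f" "\<And>x. f x \<le> p x"
    using Hahn_Banach_sublinear by blast
  have "f x \<le> norm x" for x
    using c0 f(2)[of x] le[of 0 c0 x] by simp
  from this this[of "- _"] have bound: "\<bar>f x\<bar> \<le> norm x" for x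
    by (simp add: linear_neg[OF f(1)] abs_le_iff)
  then have "bounded_linear f"
    using f(1) by (intro bounded_linear_intro[of _ 1]) (auto simp: linear_iff)
  note app = bounded_linear_Blinfun_apply[OF this]
  show ?thesis
  proof
    show "norm (Blinfun f) \<le> 1"
      using bound by (intro norm_blinfun_bound) (auto simp: app)
    fix c assume "c \<in> C"
    then have "f (- (w - c)) \<le> - d"
      using f(2)[of "- (w - c)"] le[of 1 c "- (w - c)"] by simp
    then show "d \<le> Blinfun f w - Blinfun f c"
      by (simp only: app linear_neg[OF f(1)] linear_diff[OF f(1)])
  qed
qed

text \<open>Separates \<open>w\<close> from \<open>{0}\<close> at distance \<open>norm w\<close>.
  The form \<open>norm f \<le> 1\<close> includes the trivial space, where no functional has norm
  one.\<close>

lemma norming_functional: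
  fixes w :: "'a::real_normed_vector"
  obtains f :: "'a \<Rightarrow>\<^sub>L real" where "norm f \<le> 1" "f w = norm w"
proof -
  obtain f :: "'a \<Rightarrow>\<^sub>L real" where f: "norm f \<le> 1" "norm w \<le> f w"
    using separate_point_convex[of "{0}" "norm w" w] by auto
  moreover have "f w \<le> norm w"
    using norm_blinfun[of f w] mult_right_mono[OF f(1) norm_ge_zero[of w]] by simp
  ultimately show ?thesis using that by force
qed

text \<open>The witness is sought in the open ball because that is the set which a norming bilinear
  map covers by definition.\<close>

lemma blinfun_norm_less_witness:
  fixes A :: "'a::real_normed_vector \<Rightarrow>\<^sub>L 'b::real_normed_vector"
  assumes c: "0 \<le> c" "c < norm A"
  obtains u where "norm u < 1" "c < norm (A u)"
proof -
  obtain x where x: "c * norm x < norm (A x)"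
    using norm_blinfun_bound[OF c(1), of A] c(2) by (meson not_le)
  \<comment> \<open>Dividing by \<open>r\<close> strictly above \<open>norm x\<close> puts the
    vector inside the open ball while its image stays longer than \<open>c\<close>.\<close>
  obtain r where r: "norm x < r" "c * r < norm (A x)"
  proof (cases "c = 0")
    case True
    then show ?thesis using that[of "norm x + 1"] x by simp
  next
    case False
    then have "norm x < norm (A x) / c" using x c by (simp add: field_simps)
    then obtain r where "norm x < r" "r < norm (A x) / c" using dense by blast
    then show ?thesis using that[of r] False c by (simp add: field_simps)
  qed
  have "0 < r" using r(1) norm_ge_zero[of x] by linarith
  then show ?thesis
    using r by (intro that[of "x /\<^sub>R r"]) (simp_all add: blinfun.scaleR_right field_simps)
qed

lemma functional_norm_less_witness:
  fixes g :: "'a::real_normed_vector \<Rightarrow>\<^sub>L real"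
  assumes c: "c < norm g"
  obtains u where "norm u < 1" "c < g u"
proof (cases "0 \<le> c")
  case True
  then obtain u where "norm u < 1" "c < \<bar>g u\<bar>"
    using blinfun_norm_less_witness[OF True c] by auto
  then show ?thesis
    using that[of u] that[of "- u"] by (cases "0 \<le> g u") (auto simp: blinfun.minus_right)
next
  case False
  then show ?thesis using that[of 0] by simp
qed

lemma functional_le_norm:
  fixes g :: "'a::real_normed_vector \<Rightarrow>\<^sub>L real"
  assumes "norm g \<le> a" "norm u \<le> b" "0 \<le> a"
  shows "\<bar>g u\<bar> \<le> a * b"
proof -
  have "\<bar>g u\<bar> \<le> norm g * norm u" using norm_blinfun[of g u] by simp
  also have "\<dots> \<le> a * b" using assms by (intro mult_mono) auto
  finally show ?thesis .
qed

section \<open>The norm of bilinear maps, norming maps and their slices\<close>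

lemma bilinear_norm_upper:
  assumes B: "bounded_bilinear B" and "norm x \<le> 1" "norm y \<le> 1"
  shows "norm (B x y) \<le> bilinear_norm B"
proof -
  obtain K where K: "0 \<le> K" "\<And>x y. norm (B x y) \<le> norm x * norm y * K"
    using bounded_bilinear.nonneg_bounded[OF B] by blast
  have "norm (B a b) \<le> K" if "norm a \<le> 1" "norm b \<le> 1" for a b
  proof -
    have "norm a * norm b * K \<le> 1 * 1 * K"
      using that K by (intro mult_mono) auto
    then show ?thesis using K(2)[of a b] by simp
  qed
  then have "bdd_above ((\<lambda>(x, y). norm (B x y)) ` (cball 0 1 \<times> cball 0 1))"
    by (intro bdd_aboveI2[of _ _ K]) auto
  from cSUP_upper[OF _ this, of "(x, y)"] show ?thesis
    using assms by (simp add: bilinear_norm_def)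
qed

lemma bilinear_norm_least:
  assumes "\<And>x y. norm x \<le> 1 \<Longrightarrow> norm y \<le> 1 \<Longrightarrow> norm (B x y) \<le> M"
  shows "bilinear_norm B \<le> M"
proof -
  have "(0, 0) \<in> cball 0 1 \<times> (cball 0 1 :: 'b set)" by simp
  then have "cball (0::'a) 1 \<times> (cball 0 1 :: 'b set) \<noteq> {}" by blast
  then show ?thesis
    unfolding bilinear_norm_def using assms by (intro cSUP_least) auto
qed

lemma bilinear_norm_less_witness:
  assumes "M < bilinear_norm B"
  obtains x y where "norm x \<le> 1" "norm y \<le> 1" "M < norm (B x y)"
proof (rule ccontr)
  assume "\<not> thesis"
  with that have "\<And>x y. norm x \<le> 1 \<Longrightarrow> norm y \<le> 1 \<Longrightarrow> norm (B x y) \<le> M"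
    by (meson not_le)
  from bilinear_norm_least[of B M, OF this] assms show False by simp
qed

lemma bilinear_norm_nonneg: "bounded_bilinear B \<Longrightarrow> 0 \<le> bilinear_norm B"
  using bilinear_norm_upper[of B 0 0] norm_ge_zero[of "B 0 0"] by (simp add: bounded_bilinear.zero_left)

lemma norming_bilinear_bounded: "norming_bilinear B \<Longrightarrow> bounded_bilinear B"
  by (simp add: norming_bilinear_def)

lemma norming_bilinear_onto:
  assumes "norming_bilinear B" "norm z < 1"
  obtains x y where "norm x < 1" "norm y < 1" "B x y = z"
proof -
  have "z \<in> (\<lambda>(x, y). B x y) ` (ball 0 1 \<times> ball 0 1)"
    using assms by (simp add: norming_bilinear_def)
  then show ?thesis using that by auto
qed

text \<open>If \<open>norm (B x y) > 1\<close>, scaling both arguments by the inverse square root of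
  this norm moves them into the open balls, while the value gets norm exactly one and so leaves
  \<open>ball 0 1\<close>.\<close>

lemma norming_bilinear_norm_le:
  assumes B: "norming_bilinear B" and xy: "norm x \<le> 1" "norm y \<le> 1"
  shows "norm (B x y) \<le> 1"
proof (rule ccontr)
  assume n: "\<not> norm (B x y) \<le> 1"
  interpret bounded_bilinear B using B by (rule norming_bilinear_bounded)
  define t where "t = 1 / sqrt (norm (B x y))"
  have t: "0 < t" "t < 1" "t * t * norm (B x y) = 1"
    using n by (auto simp: t_def divide_simps simp flip: real_sqrt_mult)
  have "t * norm x \<le> t" "t * norm y \<le> t"
    using xy t by (simp_all add: mult_left_le)
  then have "t * norm x < 1" "t * norm y < 1"
    using t by linarith+
  then have "t *\<^sub>R x \<in> ball 0 1" "t *\<^sub>R y \<in> ball 0 1"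
    using t by simp_all
  then have "B (t *\<^sub>R x) (t *\<^sub>R y) \<in> ball 0 1"
    using B unfolding norming_bilinear_def by blast
  then show False
    using t by (simp add: scaleR_left scaleR_right mult.assoc)
qed

lemma bounded_bilinear_pairing:
  assumes "bounded_bilinear B"
  shows "bounded_bilinear (bilinear_pairing B g)"
proof -
  interpret bounded_bilinear B by fact
  obtain K where K: "\<And>x y. norm (B x y) \<le> norm x * norm y * K"
    using bounded by blast
  have "\<bar>g (B x y)\<bar> \<le> norm x * norm y * (norm g * K)" for x y
    using functional_le_norm[OF order_refl K norm_ge_zero, of g x y] by (simp add: mult_ac)
  then show ?thesis
    unfolding bilinear_pairing_def
    by unfold_locales
      (auto simp: add_left add_right scaleR_left scaleR_right blinfun.add_right blinfun.scaleR_right)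
qed

text \<open>The values of \<open>B\<close> on the open balls fill \<open>ball 0 1\<close>, so
  \<open>g\<close> has the same supremum on them as on the whole ball.\<close>

lemma norming_bilinear_norm_pairing:
  assumes B: "norming_bilinear B"
  shows "bilinear_norm (bilinear_pairing B g) = norm g"
proof (rule antisym)
  show "bilinear_norm (bilinear_pairing B g) \<le> norm g"
    using functional_le_norm[OF order_refl norming_bilinear_norm_le[OF B], of _ _ g]
    by (intro bilinear_norm_least) (simp add: bilinear_pairing_def)
  have bb: "bounded_bilinear (bilinear_pairing B g)"
    by (intro bounded_bilinear_pairing norming_bilinear_bounded B)
  show "norm g \<le> bilinear_norm (bilinear_pairing B g)"
  proof (rule ccontr)
    assume "\<not> ?thesis"
    then obtain u where u: "norm u < 1" "bilinear_norm (bilinear_pairing B g) < g u"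
      using functional_norm_less_witness[of "bilinear_norm (bilinear_pairing B g)" g] by auto
    then obtain x y where "norm x < 1" "norm y < 1" "B x y = u"
      using norming_bilinear_onto[OF B] by metis
    then show False
      using bilinear_norm_upper[OF bb, of x y] u by (simp add: bilinear_pairing_def)
  qed
qed

text \<open>For a unit functional the normalising factor is one, so the slices are the preimages
  under \<open>B\<close> of slices of the unit ball of the target. This is the form in which they
  are handled below.\<close>

lemma bilinear_slices_norming_iff:
  fixes B :: "'a::real_normed_vector \<Rightarrow> 'b::real_normed_vector \<Rightarrow> 'c::real_normed_vector"
  assumes B: "norming_bilinear B"
  shows "S \<in> bilinear_slices B \<longleftrightarrow>
    (\<exists>(g :: _ \<Rightarrow>\<^sub>L real) \<epsilon>. norm g = 1 \<and> 0 < \<epsilon> \<and> \<epsilon> < 1 \<and>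
      S = {(x, y). norm x \<le> 1 \<and> norm y \<le> 1 \<and> 1 - \<epsilon> \<le> blinfun_apply g (B x y)})"
proof -
  have eq: "bilinear_slice (normalized_pairing B g) \<epsilon> =
      {(x, y). norm x \<le> 1 \<and> norm y \<le> 1 \<and> 1 - \<epsilon> \<le> blinfun_apply g (B x y)}"
    if "norm g = 1" for g :: "'c \<Rightarrow>\<^sub>L real" and \<epsilon>
    using that unfolding normalized_pairing_def norming_bilinear_norm_pairing[OF B]
    by (simp add: bilinear_slice_def bilinear_pairing_def)
  have "S \<in> bilinear_slices B \<longleftrightarrow> (\<exists>g \<epsilon>. norm g = 1 \<and> 0 < \<epsilon> \<and> \<epsilon> < 1 \<and>
      S = bilinear_slice (normalized_pairing B g) \<epsilon>)"
    unfolding bilinear_slices_def norming_bilinear_norm_pairing[OF B] by fastforce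
  then show ?thesis
    by (simp add: eq cong: conj_cong)
qed

lemma bilinear_slice_nonempty:
  fixes B :: "'a::real_normed_vector \<Rightarrow> 'b::real_normed_vector \<Rightarrow> 'c::real_normed_vector"
  assumes B: "norming_bilinear B" and S: "S \<in> bilinear_slices B"
  obtains x y where "(x, y) \<in> S"
proof -
  obtain g :: "'c \<Rightarrow>\<^sub>L real" and \<epsilon> where g: "norm g = 1" "0 < \<epsilon>"
      "S = {(x, y). norm x \<le> 1 \<and> norm y \<le> 1 \<and> 1 - \<epsilon> \<le> blinfun_apply g (B x y)}"
    using S unfolding bilinear_slices_norming_iff[OF B] by blast
  obtain u where u: "norm u < 1" "1 - \<epsilon> < g u"
    using functional_norm_less_witness[of "1 - \<epsilon>" g] g by auto
  obtain x y where "norm x < 1" "norm y < 1" "B x y = u"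
    using norming_bilinear_onto[OF B u(1)] by metis
  then show ?thesis
    using that[of x y] u g by auto
qed

lemma bilinear_slice_subset:
  assumes B: "norming_bilinear B" and S: "S \<in> bilinear_slices B" "(x, y) \<in> S"
  shows "norm x \<le> 1" "norm y \<le> 1"
  using S unfolding bilinear_slices_norming_iff[OF B] by auto

section \<open>Subslices from the Daugavet property\<close>

text \<open>The Daugavet equation for \<open>Q u = g u *\<^sub>R z\<close>, tested at an almost
  norming vector; \<open>z \<noteq> 0\<close> makes the rank one.\<close>

lemma daugavet_rank_one:
  fixes g :: "'z::real_normed_vector \<Rightarrow>\<^sub>L real"
  assumes D: "daugavet_property TYPE('z)" and g: "norm g = 1" and c: "0 \<le> c" "c < 1 + norm z"
    and z: "z \<noteq> 0"
  obtains u where "norm u < 1" "c < norm (u + g u *\<^sub>R z)"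
proof -
  define Q where "Q = blinfun_scaleR_left z o\<^sub>L g"
  have Q: "Q u = g u *\<^sub>R z" for u by (simp add: Q_def)
  obtain a where a: "g a \<noteq> 0"
    using functional_norm_less_witness[of 0 g] g by force
  have "range Q = span {z}"
  proof -
    have "k *\<^sub>R z = Q ((k / g a) *\<^sub>R a)" for k
      using a by (simp add: Q blinfun.scaleR_right)
    then have "k *\<^sub>R z \<in> range Q" for k by (metis rangeI)
    then show ?thesis by (auto simp: span_singleton Q)
  qed
  then have "dim (range Q) = 1"
    using z by (simp add: dim_eq_card_independent)
  moreover have "norm Q = norm z"
  proof (rule antisym)
    have "norm (Q u) \<le> norm z * norm u" for u
      using functional_le_norm[of g 1 u "norm u"] g
      by (simp add: Q mult.commute[of _ "norm z"] mult_left_mono)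
    then show "norm Q \<le> norm z" by (intro norm_blinfun_bound) auto
    have "norm g \<le> norm Q / norm z"
      using norm_blinfun[of Q] z by (intro norm_blinfun_bound) (auto simp: Q field_simps)
    then show "norm z \<le> norm Q" using g z by (simp add: field_simps)
  qed
  ultimately have "norm (id_blinfun + Q) = 1 + norm z"
    using D by (simp add: daugavet_property_def)
  then obtain u where "norm u < 1" "c < norm ((id_blinfun + Q) u)"
    using blinfun_norm_less_witness[of c "id_blinfun + Q"] c by metis
  then show ?thesis
    using that[of u] by (simp add: blinfun.add_left Q)
qed

text \<open>Let \<open>k\<close> norm \<open>u + g u *\<^sub>R z\<close> for the vector of
  \<open>daugavet_rank_one\<close>, and slice with the normalised
  \<open>F = h + a *\<^sub>R g\<close>, where \<open>h\<close> is \<open>k\<close> up to sign and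
  \<open>a = h z\<close>. On the ball \<open>h \<le> 1\<close> and
  \<open>a * g \<le> a \<le> norm z\<close>, so a value \<open>F v\<close> close to
  \<open>1 + norm z\<close> forces both summands to be close to their bounds.\<close>

lemma daugavet_subslice:
  fixes g :: "'z::real_normed_vector \<Rightarrow>\<^sub>L real" and z :: 'z
  assumes D: "daugavet_property TYPE('z)" and g: "norm g = 1" and e: "0 < e" and \<eta>: "0 < \<eta>"
  obtains f h :: "'z \<Rightarrow>\<^sub>L real" and e' where "norm f = 1" "0 < e'" "e' < 1"
    "norm h \<le> 1" "norm z - \<eta> \<le> h z"
    "\<And>u. norm u \<le> 1 \<Longrightarrow> 1 - e' \<le> f u \<Longrightarrow> 1 - e \<le> g u \<and> 1 - \<eta> \<le> h u"
proof (cases "z = 0")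
  case True
  then show ?thesis
    using g e \<eta> by (intro that[of g "min (min e \<eta>) (1/2)" g]) auto
next
  case False
  define c where "c = norm z"
  have c: "0 < c" using False by (simp add: c_def)
  \<comment> \<open>The three bounds serve \<open>1 - \<eta> \<le> h v\<close>,
    \<open>c / 2 \<le> a\<close> and \<open>1 - e \<le> g v\<close>, in this order.\<close>
  define \<delta> where "\<delta> = min (\<eta> / 2) (min (c / 2) (c * e / 4))"
  have \<delta>: "0 < \<delta>" "2 * \<delta> \<le> \<eta>" "2 * \<delta> \<le> c" "4 * \<delta> \<le> c * e"
  proof -
    show "0 < \<delta>" using c e \<eta> by (simp add: \<delta>_def)
    have "\<delta> \<le> \<eta> / 2" "\<delta> \<le> c / 2" "\<delta> \<le> c * e / 4" by (auto simp: \<delta>_def)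
    then show "2 * \<delta> \<le> \<eta>" "2 * \<delta> \<le> c" "4 * \<delta> \<le> c * e" by linarith+
  qed
  \<comment> \<open>Makes the loss \<open>e' * (1 + c)\<close> due to the width of the slice equal
    to \<open>\<delta>\<close>.\<close>
  define e' where "e' = \<delta> / (1 + c)"
  have e': "0 < e'" "e' < 1" "e' * (1 + c) = \<delta>"
    using \<delta> c by (auto simp: e'_def field_simps)
  obtain u where u: "norm u < 1" "1 + c - \<delta> < norm (u + g u *\<^sub>R z)"
    using daugavet_rank_one[OF D g, of "1 + c - \<delta>" z] False c \<delta> by (auto simp: c_def)
  obtain k :: "'z \<Rightarrow>\<^sub>L real" where k: "norm k \<le> 1" "k (u + g u *\<^sub>R z) = norm (u + g u *\<^sub>R z)"
    using norming_functional[of "u + g u *\<^sub>R z"] by auto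
  \<comment> \<open>The sign gives \<open>h z = \<bar>k z\<bar>\<close>, and \<open>F\<close> below
    is \<open>k + k z *\<^sub>R g\<close> times this sign.\<close>
  define h where "h = sgn (k z) *\<^sub>R k"
  have sgn: "\<bar>sgn (k z)\<bar> \<le> 1" by (simp add: abs_sgn_eq)
  define a where "a = \<bar>k z\<bar>"
  define F where "F = h + a *\<^sub>R g"
  \<comment> \<open>The adjoint of identity plus the rank one map:
    \<open>k (u + g u *\<^sub>R z)\<close> is the value of \<open>k + k z *\<^sub>R g\<close> at
    \<open>u\<close>. As this functional has norm at most \<open>1 + a\<close>, the estimate forces
    \<open>c - \<delta> \<le> a\<close>.\<close>
  have "1 + c - \<delta> < norm (k + k z *\<^sub>R g)"
  proof -
    have "1 + c - \<delta> < (k + k z *\<^sub>R g) u"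
      using u k by (simp add: blinfun.add_left blinfun.add_right blinfun.scaleR_left blinfun.scaleR_right mult.commute)
    also have "\<dots> \<le> norm (k + k z *\<^sub>R g) * 1"
      using functional_le_norm[OF order_refl less_imp_le[OF u(1)] norm_ge_zero, of "k + k z *\<^sub>R g"]
      by linarith
    finally show ?thesis by simp
  qed
  moreover have a1: "a \<le> c"
    using functional_le_norm[of k 1 z c] k by (simp add: a_def c_def)
  moreover have "norm (k + k z *\<^sub>R g) \<le> 1 + a"
    using norm_triangle_ineq[of k "k z *\<^sub>R g"] k g by (simp add: a_def)
  ultimately have a: "0 < a" "c - \<delta> \<le> a"
    using \<delta> c by linarith+
  have hz: "h z = a" by (simp add: h_def a_def blinfun.scaleR_left sgn_mult_abs abs_sgn mult.commute)
  have h1: "norm h \<le> 1"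
    using k sgn mult_mono[OF sgn k(1)] by (simp add: h_def)
  have "F = sgn (k z) *\<^sub>R (k + k z *\<^sub>R g)"
    by (simp add: F_def h_def a_def scaleR_add_right abs_sgn mult.commute)
  then have "norm F = norm (k + k z *\<^sub>R g)"
    using a by (simp add: a_def abs_sgn_eq)
  with \<open>1 + c - \<delta> < norm (k + k z *\<^sub>R g)\<close> have F: "1 + c - \<delta> < norm F" by simp
  then have F0: "0 < norm F" using \<delta> c by linarith
  show ?thesis
  proof
    show "norm (F /\<^sub>R norm F) = 1" using F0 by simp
    show "0 < e'" "e' < 1" by fact+
    show "norm h \<le> 1" by fact
    show "norm z - \<eta> \<le> h z" using a \<delta> by (simp add: hz c_def)
    fix v :: 'z assume v: "norm v \<le> 1" "1 - e' \<le> (F /\<^sub>R norm F) v"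
    have "(1 - e') * (1 + c - \<delta>) \<le> (1 - e') * norm F"
      using F e' by (intro mult_left_mono) auto
    also have "\<dots> \<le> F v"
      using v(2) F0 by (simp add: blinfun.scaleR_left field_simps)
    also have "\<dots> = h v + a * g v"
      by (simp add: F_def blinfun.add_left blinfun.scaleR_left)
    finally have "(1 - e') * (1 + c - \<delta>) \<le> h v + a * g v" .
    moreover have "(1 - e') * (1 + c - \<delta>) = 1 + c - \<delta> - e' * (1 + c) + e' * \<delta>"
      by (simp add: algebra_simps)
    ultimately have key: "1 + c - 2 * \<delta> \<le> h v + a * g v"
      using e' \<delta>(1) mult_pos_pos[of e' \<delta>] by linarith
    have hv: "h v \<le> 1" using functional_le_norm[OF h1 v(1)] by simp
    have gv: "g v \<le> 1" using functional_le_norm[of g 1 v 1] g v(1) by simp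
    have "a * g v \<le> a" using gv a by simp
    then have "1 - \<eta> \<le> h v" using key a1 \<delta> by linarith
    moreover have "1 - e \<le> g v"
    proof -
      have "a * (1 - g v) \<le> 2 * \<delta>" using key hv a1 by (simp add: algebra_simps)
      moreover have "c * (1 - g v) / 2 \<le> a * (1 - g v)"
        using gv a \<delta> mult_right_mono[of "c / 2" a "1 - g v"] by simp
      ultimately have "c * (1 - g v) \<le> c * e" using \<delta>(4) by linarith
      then show ?thesis using c by simp
    qed
    ultimately show "1 - e \<le> g v \<and> 1 - \<eta> \<le> h v" by simp
  qed
qed

text \<open>One functional certifies \<open>norm (B x y + z) \<ge> 1 + norm z - 2 * \<eta>\<close>
  on all of \<open>S\<close>. The functional itself is recorded because it is later evaluated at
  vectors other than \<open>z\<close>.\<close>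

definition jointly_normed ::
    "('x \<Rightarrow> 'y \<Rightarrow> 'z::real_normed_vector) \<Rightarrow> ('x \<times> 'y) set \<Rightarrow> real \<Rightarrow> 'z \<Rightarrow> bool" where
  "jointly_normed B S \<eta> z \<longleftrightarrow> (\<exists>h :: 'z \<Rightarrow>\<^sub>L real. norm h \<le> 1 \<and> norm z - \<eta> \<le> blinfun_apply h z \<and>
     (\<forall>x y. (x, y) \<in> S \<longrightarrow> 1 - \<eta> \<le> blinfun_apply h (B x y)))"

lemma jointly_normedE:
  fixes B :: "'x \<Rightarrow> 'y \<Rightarrow> 'z::real_normed_vector"
  assumes "jointly_normed B S \<eta> z"
  obtains h :: "'z \<Rightarrow>\<^sub>L real" where "norm h \<le> 1" "norm z - \<eta> \<le> h z"
    "\<And>x y. (x, y) \<in> S \<Longrightarrow> 1 - \<eta> \<le> h (B x y)"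
  using assms unfolding jointly_normed_def by blast

lemma jointly_normed_mono:
  "jointly_normed B S \<eta> z \<Longrightarrow> S' \<subseteq> S \<Longrightarrow> jointly_normed B S' \<eta> z"
  unfolding jointly_normed_def by blast

text \<open>The same functional serves: \<open>norm z\<close> and \<open>h z\<close> each change by
  at most \<open>\<delta>\<close>.\<close>

lemma jointly_normed_near:
  fixes B :: "'x \<Rightarrow> 'y \<Rightarrow> 'z::real_normed_vector"
  assumes z: "jointly_normed B S \<eta> z" and p: "norm (z - p) \<le> \<delta>" and \<eta>: "\<eta> + 2 * \<delta> \<le> \<eta>'"
  shows "jointly_normed B S \<eta>' p"
proof -
  obtain h :: "'z \<Rightarrow>\<^sub>L real" where h: "norm h \<le> 1" "norm z - \<eta> \<le> h z"
    "\<And>x y. (x, y) \<in> S \<Longrightarrow> 1 - \<eta> \<le> h (B x y)"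
    using jointly_normedE[OF z] by metis
  have "\<bar>h z - h p\<bar> \<le> \<delta>"
    using functional_le_norm[OF h(1) p] by (simp add: blinfun.diff_right)
  moreover have "norm p \<le> norm z + norm (z - p)"
    using norm_triangle_ineq4[of z "z - p"] by simp
  ultimately have hp: "norm p - \<eta>' \<le> h p" using h(2) p \<eta> by linarith
  have "\<eta> \<le> \<eta>'" using p \<eta> norm_ge_zero[of "z - p"] by linarith
  then have "1 - \<eta>' \<le> h (B x y)" if "(x, y) \<in> S" for x y using h(3)[OF that] by linarith
  with h(1) hp show ?thesis unfolding jointly_normed_def by blast
qed

text \<open>The pullback of \<open>daugavet_subslice\<close> along \<open>B\<close>, whose values on
  the closed unit balls stay in the unit ball.\<close>

lemma norming_daugavet_subslice:
  fixes B :: "'x::real_normed_vector \<Rightarrow> 'y::real_normed_vector \<Rightarrow> 'z::real_normed_vector" and z :: 'z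
  assumes D: "daugavet_property TYPE('z)" and B: "norming_bilinear B"
    and S: "S \<in> bilinear_slices B" and \<eta>: "0 < \<eta>"
  obtains S' where "S' \<in> bilinear_slices B" "S' \<subseteq> S" "jointly_normed B S' \<eta> z"
proof -
  obtain g :: "'z \<Rightarrow>\<^sub>L real" and e where g: "norm g = 1" "0 < e"
      "S = {(x, y). norm x \<le> 1 \<and> norm y \<le> 1 \<and> 1 - e \<le> g (B x y)}"
    using S unfolding bilinear_slices_norming_iff[OF B] by blast
  obtain f h :: "'z \<Rightarrow>\<^sub>L real" and e' where f: "norm f = 1" "0 < e'" "e' < 1"
    and h: "norm h \<le> 1" "norm z - \<eta> \<le> h z"
    and sub: "\<And>u. norm u \<le> 1 \<Longrightarrow> 1 - e' \<le> f u \<Longrightarrow> 1 - e \<le> g u \<and> 1 - \<eta> \<le> h u"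
    using daugavet_subslice[OF D g(1,2) \<eta>, of z] by metis
  define S' where "S' = {(x, y). norm x \<le> 1 \<and> norm y \<le> 1 \<and> 1 - e' \<le> f (B x y)}"
  have in_S': "1 - e \<le> g (B x y) \<and> 1 - \<eta> \<le> h (B x y)" if "(x, y) \<in> S'" for x y
    using that by (intro sub norming_bilinear_norm_le[OF B]) (simp_all add: S'_def)
  show ?thesis
  proof
    show "S' \<in> bilinear_slices B"
      unfolding bilinear_slices_norming_iff[OF B] S'_def using f by blast
    show "S' \<subseteq> S" using in_S' by (auto simp: g(3)) (simp_all add: S'_def)
    show "jointly_normed B S' \<eta> z"
      unfolding jointly_normed_def using h in_S' by blast
  qed
qed

text \<open>The slice is shrunk once per vector; smaller slices keep the functionals already
  found.\<close>

lemma norming_daugavet_subslice_finite: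
  fixes B :: "'x::real_normed_vector \<Rightarrow> 'y::real_normed_vector \<Rightarrow> 'z::real_normed_vector" and F :: "'z set"
  assumes D: "daugavet_property TYPE('z)" and B: "norming_bilinear B"
    and S: "S \<in> bilinear_slices B" and \<eta>: "0 < \<eta>" and F: "finite F"
  shows "\<exists>S'\<in>bilinear_slices B. S' \<subseteq> S \<and> (\<forall>z\<in>F. jointly_normed B S' \<eta> z)"
  using F
proof (induction F rule: finite_induct)
  case empty
  then show ?case using S by blast
next
  case (insert a F)
  then obtain S' where S': "S' \<in> bilinear_slices B" "S' \<subseteq> S" "\<forall>z\<in>F. jointly_normed B S' \<eta> z"
    by blast
  obtain S'' where S'': "S'' \<in> bilinear_slices B" "S'' \<subseteq> S'" "jointly_normed B S'' \<eta> a"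
    using norming_daugavet_subslice[OF D B S'(1) \<eta>] .
  then have "\<forall>z\<in>insert a F. jointly_normed B S'' \<eta> z"
    using S'(3) jointly_normed_mono[of B S' \<eta> _ S''] by blast
  then show ?case using S' S'' by blast
qed

text \<open>A finite \<open>\<eta> / 3\<close>-net with error \<open>\<eta> / 3\<close> suffices,
  since passing from the net to \<open>K\<close> costs another
  \<open>2 * \<eta> / 3\<close>.\<close>

lemma norming_daugavet_subslice_compact:
  fixes B :: "'x::real_normed_vector \<Rightarrow> 'y::real_normed_vector \<Rightarrow> 'z::real_normed_vector" and K :: "'z set"
  assumes D: "daugavet_property TYPE('z)" and B: "norming_bilinear B"
    and S: "S \<in> bilinear_slices B" and \<eta>: "0 < \<eta>" and K: "compact K"
  shows "\<exists>S'\<in>bilinear_slices B. S' \<subseteq> S \<and> (\<forall>z\<in>K. jointly_normed B S' \<eta> z)"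
proof -
  have \<eta>3: "0 < \<eta> / 3" using \<eta> by simp
  obtain F where F: "finite F" "K \<subseteq> (\<Union>z\<in>F. ball z (\<eta> / 3))"
    using seq_compact_imp_totally_bounded[OF compact_imp_seq_compact[OF K]] \<eta>3 by blast
  obtain S' where S': "S' \<in> bilinear_slices B" "S' \<subseteq> S" "\<forall>z\<in>F. jointly_normed B S' (\<eta> / 3) z"
    using norming_daugavet_subslice_finite[OF D B S \<eta>3 F(1)] by blast
  have "jointly_normed B S' \<eta> p" if "p \<in> K" for p
  proof -
    obtain z where z: "z \<in> F" "norm (z - p) < \<eta> / 3"
      using F(2) \<open>p \<in> K\<close> by (auto simp: dist_norm)
    show ?thesis
      using S'(3) z by (intro jointly_normed_near[of B S' "\<eta> / 3" z p "\<eta> / 3"]) auto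
  qed
  then show ?thesis using S' by blast
qed

section \<open>Weak cluster points and Mazur's theorem\<close>

lemma openin_weak_topology_vimage:
  fixes f :: "'z::real_normed_vector \<Rightarrow>\<^sub>L real"
  shows "open U \<Longrightarrow> openin weak_topology (blinfun_apply f -` U)"
  unfolding weak_topology_def by (intro topology_generated_by_Basis CollectI exI[of _ f] exI[of _ U] conjI refl)

lemma topspace_weak_topology [simp]: "topspace weak_topology = UNIV"
  using openin_subset[OF openin_weak_topology_vimage[OF open_UNIV, of 0]] by auto

text \<open>Otherwise each point of \<open>K\<close> has a neighbourhood that the sequence
  eventually leaves; finitely many of them cover \<open>K\<close>, and a late term lies in
  none.\<close>

lemma compactin_cluster_point:
  assumes K: "compactin X K" and s: "\<And>n::nat. s n \<in> K"
  shows "\<exists>w\<in>K. \<forall>U N. openin X U \<longrightarrow> w \<in> U \<longrightarrow> (\<exists>n\<ge>N. s n \<in> U)"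
proof (rule ccontr)
  assume "\<not> ?thesis"
  then have "\<forall>w\<in>K. \<exists>U N. openin X U \<and> w \<in> U \<and> (\<forall>n\<ge>N. s n \<notin> U)" by simp
  then obtain U where "\<forall>w\<in>K. \<exists>N. openin X (U w) \<and> w \<in> U w \<and> (\<forall>n\<ge>N. s n \<notin> U w)"
    by (rule bchoice[THEN exE])
  then obtain N where UN: "\<forall>w\<in>K. openin X (U w) \<and> w \<in> U w \<and> (\<forall>n\<ge>N w. s n \<notin> U w)"
    by (rule bchoice[THEN exE])
  have "\<forall>V\<in>U ` K. openin X V" "K \<subseteq> \<Union>(U ` K)" using UN by auto
  then obtain \<F> where \<F>: "finite \<F>" "\<F> \<subseteq> U ` K" "K \<subseteq> \<Union>\<F>"
    using K unfolding compactin_def by meson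
  then obtain W where W: "finite W" "W \<subseteq> K" "\<F> = U ` W"
    using finite_subset_image by metis
  define n where "n = Max (insert 0 (N ` W))"
  have "N w \<le> n" if "w \<in> W" for w
    using W(1) that by (auto simp: n_def)
  then have "s n \<notin> \<Union>\<F>" using W UN by auto
  then show False using \<F>(3) s by blast
qed

text \<open>Mazur's theorem for tails: a functional separating \<open>w\<close> from the hull by
  \<open>e\<close> would yield a weak neighbourhood of \<open>w\<close> missing every
  \<open>s n\<close> with \<open>n \<ge> N\<close>.\<close>

lemma weak_cluster_point_near_convex_hull:
  fixes w :: "'z::real_normed_vector"
  assumes w: "\<And>U N. openin weak_topology U \<Longrightarrow> w \<in> U \<Longrightarrow> \<exists>n\<ge>N. s n \<in> U"
    and e: "0 < e"
  obtains q where "q \<in> convex hull (s ` {N::nat..})" "norm (w - q) < e"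
proof (rule ccontr)
  assume "\<not> thesis"
  with that have far: "\<And>c. c \<in> convex hull (s ` {N..}) \<Longrightarrow> e \<le> norm (w - c)"
    by (meson not_le)
  obtain f :: "'z \<Rightarrow>\<^sub>L real" where f: "\<And>c. c \<in> convex hull (s ` {N..}) \<Longrightarrow> e \<le> f w - f c"
  proof (rule separate_point_convex[of "convex hull (s ` {N..})" e w])
    show "convex hull (s ` {N..}) \<noteq> {}" by (simp add: convex_hull_eq_empty)
  qed (use far in auto)
  have "\<exists>n\<ge>N. s n \<in> blinfun_apply f -` {f w - e<..}"
    using e by (intro w openin_weak_topology_vimage) auto
  then obtain n where n: "N \<le> n" "f w - e < f (s n)" by auto
  then have "s n \<in> convex hull (s ` {N..})" by (auto intro: hull_inc)
  from f[OF this] n(2) show False by simp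
qed

lemma linear_bound_convex_hull:
  assumes p: "p \<in> convex hull V" and le: "\<And>v. v \<in> V \<Longrightarrow> blinfun_apply f v \<le> (c::real)"
  shows "blinfun_apply f p \<le> c"
proof -
  have "convex (blinfun_apply f -` {..c})"
    by (intro convex_linear_vimage blinfun.bounded_linear_right[THEN bounded_linear.linear])
       simp
  then have "convex hull V \<subseteq> blinfun_apply f -` {..c}"
    using le by (intro hull_minimal) auto
  then show ?thesis using p by auto
qed

section \<open>Nested slices and a weakly compact set of values\<close>

text \<open>Here \<open>c\<close> bounds \<open>k\<close> from below on the values of
  \<open>B\<close> over \<open>S\<close> and is later close to the norm of \<open>B\<close>. The
  functional \<open>k\<close> prevents convex combinations of these values from becoming
  short.\<close>

lemma daugavet_weakly_compact_sum:
  fixes B0 B :: "'x::real_normed_vector \<Rightarrow> 'y::real_normed_vector \<Rightarrow> 'z::real_normed_vector"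
    and k :: "'z \<Rightarrow>\<^sub>L real"
  assumes D: "daugavet_property TYPE('z)" and B0: "norming_bilinear B0"
    and K: "compactin weak_topology K" "\<And>x y. norm x \<le> 1 \<Longrightarrow> norm y \<le> 1 \<Longrightarrow> B x y \<in> K"
    and S: "S \<in> bilinear_slices B0" and k: "norm k \<le> 1" "\<And>x y. (x, y) \<in> S \<Longrightarrow> c \<le> k (B x y)"
    and \<eta>: "0 < \<eta>"
  obtains x y where "norm x \<le> 1" "norm y \<le> 1" "1 + c - \<eta> \<le> norm (B0 x y + B x y)"
proof -
  \<comment> \<open>One \<open>\<delta>\<close> is lost at each of four places: \<open>h\<close> at
    \<open>p\<close>, the passage from \<open>p\<close> to \<open>q\<close>, the passage from
    \<open>q\<close> to some \<open>v m\<close>, and \<open>h\<close> on the values of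
    \<open>B0\<close>.\<close>
  define \<delta> where "\<delta> = \<eta> / 4"
  have \<delta>: "0 < \<delta>" using \<eta> by (simp add: \<delta>_def)
  \<comment> \<open>A state is a slice with a finite set collecting the values of \<open>B\<close>
    picked so far; the slice must have a functional for every vector in the hull of this set.
    \<open>(S, {})\<close> is a state because the empty set has empty hull.\<close>
  let ?good = "\<lambda>S V. \<forall>z\<in>convex hull V. jointly_normed B0 S \<delta> z"
  let ?Q = "\<lambda>(S, V) (S', V'). S' \<subseteq> S \<and> (\<exists>(x, y)\<in>S. V' = insert (B x y) V)"
  let ?P = "\<lambda>(S', V). S' \<in> bilinear_slices B0 \<and> S' \<subseteq> S \<and> finite V \<and> ?good S' V"
  have "\<exists>f. \<forall>n::nat. ?P (f n) \<and> ?Q (f n) (f (Suc n))"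
  proof (rule dependent_nat_choice, goal_cases)
    case 1
    show ?case by (rule exI[of _ "(S, {})"]) (use S in auto)
  next
    case (2 T n)
    obtain S' V where T: "T = (S', V)" by (cases T)
    from 2 have S': "S' \<in> bilinear_slices B0" "S' \<subseteq> S" "finite V" by (auto simp: T)
    obtain x y where xy: "(x, y) \<in> S'" using bilinear_slice_nonempty[OF B0 S'(1)] by metis
    let ?V = "insert (B x y) V"
    \<comment> \<open>The hull of a finite set is compact, so a single subslice serves all its
      vectors.\<close>
    have "compact (convex hull ?V)" using S' by (intro finite_imp_compact_convex_hull) simp
    from norming_daugavet_subslice_compact[OF D B0 S'(1) \<delta> this]
    obtain S'' where "S'' \<in> bilinear_slices B0" "S'' \<subseteq> S'" "?good S'' ?V" by blast
    then show ?case
      using S' xy by (intro exI[of _ "(S'', ?V)"]) (auto simp: T)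
  qed
  then obtain f where f: "\<forall>n::nat. ?P (f n) \<and> ?Q (f n) (f (Suc n))" ..
  define T where "T n = fst (f n)" for n
  define V where "V n = snd (f n)" for n
  have fTV: "f n = (T n, V n)" for n by (simp add: T_def V_def)
  have T: "T n \<in> bilinear_slices B0" "T n \<subseteq> S" "?good (T n) (V n)" for n
    using f[rule_format, of n] by (auto simp: fTV)
  have dec: "T (Suc n) \<subseteq> T n" for n using f[rule_format, of n] by (simp add: fTV)
  have "\<exists>x y. (x, y) \<in> T n \<and> V (Suc n) = insert (B x y) (V n)" for n
    using f[rule_format, of n] by (auto simp: fTV)
  then obtain X Y where XY: "\<And>n. (X n, Y n) \<in> T n" "\<And>n. V (Suc n) = insert (B (X n) (Y n)) (V n)"
    by metis
  define v where "v n = B (X n) (Y n)" for n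
  \<comment> \<open>The value \<open>v m\<close> enters at stage \<open>m + 1\<close>; so
    \<open>V N\<close> contains the values of index below \<open>N\<close>, while the points of
    index at least \<open>N\<close> lie in \<open>T N\<close>.\<close>
  have V: "v m \<in> V n" if "m < n" for m n
    using that by (induction n) (auto simp: XY v_def less_Suc_eq)
  have XYT: "(X m, Y m) \<in> T n" if "n \<le> m" for m n
    using lift_Suc_antimono_le[of T, OF dec that] XY(1)[of m] by blast
  have XY1: "norm (X n) \<le> 1" "norm (Y n) \<le> 1" for n
    using bilinear_slice_subset[OF B0 T(1) XY(1)] by auto
  have "v n \<in> K" for n using K(2) XY1 by (simp add: v_def)
  then obtain w where w: "\<And>U N. openin weak_topology U \<Longrightarrow> w \<in> U \<Longrightarrow> \<exists>n\<ge>N. v n \<in> U"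
    using compactin_cluster_point[OF K(1), of v] by blast
  have kv: "c \<le> k (v n)" for n
    using k(2) T(2) XY(1) unfolding v_def by blast
  \<comment> \<open>First \<open>p\<close> is taken from the hull of all values. It involves
    finitely many of them, which fixes \<open>N\<close>; only then is \<open>q\<close> taken from
    the tail starting at \<open>N\<close>.\<close>
  obtain p where p: "p \<in> convex hull (range v)" "norm (w - p) < \<delta> / 2"
    using weak_cluster_point_near_convex_hull[OF w, where e = "\<delta> / 2" and N = 0] \<delta> by (auto simp: atLeast_0)
  obtain F where F: "finite F" "F \<subseteq> range v" "p \<in> convex hull F"
    using p(1) by (auto simp: convex_hull_explicit)
  then obtain I where I: "finite I" "F = v ` I"
    by (meson finite_subset_image)
  \<comment> \<open>\<open>Suc\<close> because \<open>V N\<close> is only known to contain values of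
    index strictly below \<open>N\<close>; the \<open>0\<close> keeps \<open>Max\<close> defined for
    empty \<open>I\<close>.\<close>
  define N where "N = Suc (Max (insert 0 I))"
  have "m < N" if "m \<in> I" for m
    using I(1) that by (auto simp: N_def less_Suc_eq_le)
  then have "F \<subseteq> V N" using I V by auto
  then have pV: "p \<in> convex hull (V N)" using F(3) hull_mono by blast
  have "jointly_normed B0 (T N) \<delta> p" using T(3)[of N] pV by blast
  then obtain h :: "'z \<Rightarrow>\<^sub>L real" where h: "norm h \<le> 1" "norm p - \<delta> \<le> h p"
    "\<And>x y. (x, y) \<in> T N \<Longrightarrow> 1 - \<delta> \<le> h (B0 x y)"
    using jointly_normedE by metis
  \<comment> \<open>Passing to \<open>- k\<close> turns the lower bound into an upper one; the
    outcome is \<open>c \<le> k p \<le> norm p\<close>.\<close>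
  have "(- k) p \<le> - c"
    by (rule linear_bound_convex_hull[OF p(1)]) (use kv in \<open>auto simp: blinfun.minus_left\<close>)
  then have "c \<le> norm p"
    using functional_le_norm[OF k(1) order_refl, of p] by (simp add: blinfun.minus_left)
  obtain q where q: "q \<in> convex hull (v ` {N..})" "norm (w - q) < \<delta> / 2"
    using weak_cluster_point_near_convex_hull[OF w, where e = "\<delta> / 2" and N = N] \<delta> by auto
  have "norm (p - q) \<le> \<delta>"
    using norm_triangle_ineq4[of "w - q" "w - p"] p(2) q(2) by simp
  from functional_le_norm[OF h(1) this] have "h p - \<delta> \<le> h q"
    by (simp add: blinfun.diff_right)
  with h(2) \<open>c \<le> norm p\<close> have hq: "c - 2 * \<delta> \<le> h q" by simp
  \<comment> \<open>\<open>h q\<close> is an average of values \<open>h (v m)\<close> with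
    \<open>m \<ge> N\<close>, so one of them is hardly smaller; the corresponding point lies in
    \<open>T N\<close>, where \<open>h\<close> is almost one on \<open>B0\<close>.\<close>
  obtain m where m: "N \<le> m" "c - 3 * \<delta> < h (v m)"
  proof (rule ccontr)
    assume "\<not> thesis"
    with that have "h (v m) \<le> c - 3 * \<delta>" if "N \<le> m" for m
      using that not_le by blast
    then have "h q \<le> c - 3 * \<delta>"
      by (intro linear_bound_convex_hull[OF q(1)]) auto
    with hq \<delta> show False by simp
  qed
  have "1 - \<delta> \<le> h (B0 (X m) (Y m))" using h(3) XYT[OF m(1)] by blast
  with m(2) have "1 + c - \<eta> \<le> h (B0 (X m) (Y m) + B (X m) (Y m))"
    by (simp add: blinfun.add_right v_def \<delta>_def)
  also have "\<dots> \<le> norm (B0 (X m) (Y m) + B (X m) (Y m))"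
    using functional_le_norm[OF h(1) order_refl, of "B0 (X m) (Y m) + B (X m) (Y m)"] by simp
  finally show ?thesis using that XY1 by blast
qed

section \<open>The norm of the sum under either of the two hypotheses\<close>

lemma norm_ptensor_le: "norm (x \<otimes>\<^sub>\<pi> y) \<le> norm x * norm y"
  using proj_norm_le[of "[(x, y)]"]
  by (simp add: ptensor_def norm_proj_tensor_of_alg alg_tensor.abs_eq)

lemma norming_bilinear_norm_add_le:
  assumes "norming_bilinear B0" "bounded_bilinear B"
    and "norm x \<le> 1" "norm y \<le> 1"
  shows "norm (B0 x y + B x y) \<le> 1 + bilinear_norm B"
  using norm_triangle_ineq[of "B0 x y" "B x y"] norming_bilinear_norm_le[OF assms(1,3,4)]
    bilinear_norm_upper[OF assms(2-4)] by linarith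

lemma bounded_bilinear_add:
  assumes "bounded_bilinear B0" "bounded_bilinear B"
  shows "bounded_bilinear (\<lambda>x y. B0 x y + B x y)"
proof -
  interpret B0: bounded_bilinear B0 by fact
  interpret B: bounded_bilinear B by fact
  obtain K0 where K0: "\<And>x y. norm (B0 x y) \<le> norm x * norm y * K0"
    using B0.bounded by blast
  obtain K where K: "\<And>x y. norm (B x y) \<le> norm x * norm y * K"
    using B.bounded by blast
  have "norm (B0 x y + B x y) \<le> norm x * norm y * (K0 + K)" for x y
    using norm_triangle_mono[OF K0 K] by (simp add: distrib_left)
  then show ?thesis
    by unfold_locales (auto simp: B0.add_left B0.add_right B0.scaleR_left B0.scaleR_right
        B.add_left B.add_right B.scaleR_left B.scaleR_right scaleR_add_right)
qed

text \<open>The upper estimate is the triangle inequality, so only near-attainment is left to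
  check.\<close>

lemma bilinear_norm_add_eqI:
  assumes B0: "norming_bilinear B0" and B: "bounded_bilinear B"
    and approx: "\<And>\<eta>. 0 < \<eta> \<Longrightarrow> \<exists>x y. norm x \<le> 1 \<and> norm y \<le> 1 \<and>
      1 + bilinear_norm B - \<eta> \<le> norm (B0 x y + B x y)"
  shows "bilinear_norm (\<lambda>x y. B0 x y + B x y) = 1 + bilinear_norm B"
proof (rule antisym)
  show "bilinear_norm (\<lambda>x y. B0 x y + B x y) \<le> 1 + bilinear_norm B"
    by (intro bilinear_norm_least norming_bilinear_norm_add_le B0 B)
  note bb = bounded_bilinear_add[OF norming_bilinear_bounded[OF B0] B]
  show "1 + bilinear_norm B \<le> bilinear_norm (\<lambda>x y. B0 x y + B x y)"
  proof (rule field_le_epsilon)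
    fix \<eta> :: real assume "0 < \<eta>"
    with approx obtain x y where "norm x \<le> 1" "norm y \<le> 1"
      "1 + bilinear_norm B - \<eta> \<le> norm (B0 x y + B x y)" by blast
    then show "1 + bilinear_norm B \<le> bilinear_norm (\<lambda>x y. B0 x y + B x y) + \<eta>"
      using bilinear_norm_upper[OF bb, of x y] by simp
  qed
qed

text \<open>\<open>norming_daugavet_subslice\<close> is applied to the centre
  \<open>bilinear_norm B *\<^sub>R z\<close>, whose length is the full norm of \<open>B\<close>. The
  error \<open>\<eta> / 3\<close> occurs at the centre, at the values of \<open>B0\<close>, and in
  the distance from the centre to the values of \<open>B\<close>.\<close>

lemma bilinear_norm_add_slice:
  fixes B0 B :: "'x::real_normed_vector \<Rightarrow> 'y::real_normed_vector \<Rightarrow> 'z::real_normed_vector"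
  assumes D: "daugavet_property TYPE('z)" and B0: "norming_bilinear B0" and B: "bounded_bilinear B"
    and S: "\<And>\<epsilon>. 0 < \<epsilon> \<Longrightarrow> \<exists>S\<in>bilinear_slices B0. \<exists>z\<in>sphere 0 1.
      (\<lambda>(x, y). B x y) ` S \<subseteq> cball (bilinear_norm B *\<^sub>R z) \<epsilon>"
  shows "bilinear_norm (\<lambda>x y. B0 x y + B x y) = 1 + bilinear_norm B"
proof (rule bilinear_norm_add_eqI[OF B0 B])
  fix \<eta> :: real assume "0 < \<eta>"
  then have \<eta>: "0 < \<eta> / 3" by simp
  let ?L = "bilinear_norm B"
  obtain S z where S: "S \<in> bilinear_slices B0" and z: "norm z = 1"
    and near: "\<And>x y. (x, y) \<in> S \<Longrightarrow> norm (?L *\<^sub>R z - B x y) \<le> \<eta> / 3"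
    using S[OF \<eta>] by (fastforce simp: dist_norm)
  obtain S' where S': "S' \<in> bilinear_slices B0" "S' \<subseteq> S" "jointly_normed B0 S' (\<eta> / 3) (?L *\<^sub>R z)"
    using norming_daugavet_subslice[OF D B0 S \<eta>] .
  then obtain h :: "'z \<Rightarrow>\<^sub>L real" where h: "norm h \<le> 1" "norm (?L *\<^sub>R z) - \<eta> / 3 \<le> h (?L *\<^sub>R z)"
      "\<And>x y. (x, y) \<in> S' \<Longrightarrow> 1 - \<eta> / 3 \<le> h (B0 x y)"
    using jointly_normedE by metis
  obtain x y where xy: "(x, y) \<in> S'" using bilinear_slice_nonempty[OF B0 S'(1)] by metis
  have "\<bar>h (?L *\<^sub>R z) - blinfun_apply h (B x y)\<bar> \<le> \<eta> / 3"
    using functional_le_norm[OF h(1) near] xy S'(2) by (force simp: blinfun.diff_right)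
  moreover have "norm (?L *\<^sub>R z) = ?L" using z bilinear_norm_nonneg[OF B] by simp
  ultimately have "1 + ?L - \<eta> \<le> h (B0 x y) + h (B x y)"
    using h(2) h(3)[OF xy] by linarith
  also have "\<dots> = h (B0 x y + B x y)"
    by (simp add: blinfun.add_right)
  also have "\<dots> \<le> norm (B0 x y + B x y)"
    using functional_le_norm[OF h(1) order_refl, of "B0 x y + B x y"] by simp
  finally show "\<exists>x y. norm x \<le> 1 \<and> norm y \<le> 1 \<and> 1 + ?L - \<eta> \<le> norm (B0 x y + B x y)"
    using bilinear_slice_subset[OF B0 S'(1) xy] by blast
qed

text \<open>Provides the input of \<open>daugavet_weakly_compact_sum\<close>: \<open>k\<close> norms
  an almost maximal value of \<open>B\<close>, and \<open>slices_le\<close> yields a slice of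
  \<open>B0\<close> whose elementary tensors lie in the slice of the adjoint at \<open>k\<close>, so
  that \<open>k\<close> is almost the norm of \<open>B\<close> on the values of \<open>B\<close>
  there.\<close>

lemma bilinear_norm_add_weakly_compact:
  fixes B0 B :: "'x::banach \<Rightarrow> 'y::banach \<Rightarrow> 'z::banach"
  assumes D: "daugavet_property TYPE('z)" and B0: "norming_bilinear B0" and B: "bounded_bilinear B"
    and le: "slices_le (operator_slices (linearisation B)) (bilinear_slices B0)"
    and wc: "weakly_compact_operator (linearisation B)" and pos: "0 < bilinear_norm B"
  shows "bilinear_norm (\<lambda>x y. B0 x y + B x y) = 1 + bilinear_norm B"
proof (rule bilinear_norm_add_eqI[OF B0 B])
  fix \<eta>' :: real assume \<eta>': "0 < \<eta>'"
  let ?L = "bilinear_norm B" and ?T = "linearisation B"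
  \<comment> \<open>The cap by \<open>?L\<close> ensures that the adjoint at \<open>k\<close> is
    nonzero and that the width \<open>\<epsilon>\<close> below is less than one.\<close>
  define \<eta> where "\<eta> = min \<eta>' ?L"
  have \<eta>: "0 < \<eta>" "\<eta> \<le> \<eta>'" "\<eta> \<le> ?L" using \<eta>' pos by (auto simp: \<eta>_def)
  obtain x0 y0 where x0: "norm x0 \<le> 1" "norm y0 \<le> 1" "?L - \<eta> / 3 < norm (B x0 y0)"
    using bilinear_norm_less_witness[of "?L - \<eta> / 3" B] \<eta>(1) by auto
  obtain k :: "'z \<Rightarrow>\<^sub>L real" where k: "norm k \<le> 1" "k (B x0 y0) = norm (B x0 y0)"
    using norming_functional by blast
  let ?A = "blinfun_adjoint ?T k"
  have tensor1: "norm (x \<otimes>\<^sub>\<pi> y) \<le> 1" if "norm x \<le> 1" "norm y \<le> 1" for x :: 'x and y :: 'y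
    using norm_ptensor_le[of x y] mult_le_one[OF that(1) norm_ge_zero that(2)] by linarith
  have A: "?A (x \<otimes>\<^sub>\<pi> y) = k (B x y)" for x y
    by (simp add: blinfun_adjoint_def linearisation_apply[OF B])
  \<comment> \<open>Elementary tensors of vectors in the unit balls have norm at most one, so
    \<open>k (B x0 y0)\<close> bounds the norm of the adjoint at \<open>k\<close> from
    below.\<close>
  have An: "?L - \<eta> / 3 < norm ?A"
    using functional_le_norm[OF order_refl tensor1[OF x0(1,2)] norm_ge_zero, of ?A] x0(3) k(2) A
    by simp
  then have A0: "0 < norm ?A" using \<eta> by linarith
  \<comment> \<open>With \<open>\<epsilon> * ?L = \<eta> / 3\<close> the slice loses at most as much
    as the choice of \<open>x0\<close> and \<open>y0\<close> did.\<close>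
  define \<epsilon> where "\<epsilon> = \<eta> / (3 * ?L)"
  have \<epsilon>: "0 < \<epsilon>" "\<epsilon> < 1" "\<epsilon> * ?L = \<eta> / 3"
    using \<eta> pos by (auto simp: \<epsilon>_def field_simps)
  have "functional_slice (?A /\<^sub>R norm ?A) \<epsilon> \<in> operator_slices ?T"
    using \<epsilon> A0 unfolding operator_slices_def by force
  then obtain S where S: "S \<in> bilinear_slices B0"
    "(\<lambda>(x, y). x \<otimes>\<^sub>\<pi> y) ` S \<subseteq> functional_slice (?A /\<^sub>R norm ?A) \<epsilon>"
    using le unfolding slices_le_def by blast
  have kS: "?L - 2 * \<eta> / 3 \<le> k (B x y)" if "(x, y) \<in> S" for x y
  proof -
    have "x \<otimes>\<^sub>\<pi> y \<in> functional_slice (?A /\<^sub>R norm ?A) \<epsilon>" using that S(2) by auto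
    then have "(1 - \<epsilon>) * norm ?A \<le> k (B x y)"
      using A0 by (simp add: functional_slice_def blinfun.scaleR_left A field_simps)
    moreover have "(1 - \<epsilon>) * (?L - \<eta> / 3) \<le> (1 - \<epsilon>) * norm ?A"
      using An \<epsilon> by (intro mult_left_mono) auto
    moreover have "(1 - \<epsilon>) * (?L - \<eta> / 3) = ?L - \<eta> / 3 - \<epsilon> * ?L + \<epsilon> * (\<eta> / 3)"
      by (simp add: field_simps)
    ultimately show ?thesis using \<epsilon> \<eta> mult_pos_pos[of \<epsilon> "\<eta> / 3"] by linarith
  qed
  let ?K = "weak_topology closure_of (blinfun_apply ?T ` cball 0 1)"
  have K: "compactin weak_topology ?K" using wc by (simp add: weakly_compact_operator_def)
  have BK: "B x y \<in> ?K" if "norm x \<le> 1" "norm y \<le> 1" for x y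
  proof -
    have "B x y = ?T (x \<otimes>\<^sub>\<pi> y)" by (simp add: linearisation_apply[OF B])
    then have "B x y \<in> blinfun_apply ?T ` cball 0 1" using tensor1[OF that] by auto
    then show ?thesis
      using closure_of_subset[of "blinfun_apply ?T ` cball 0 1" weak_topology] by auto
  qed
  have "0 < \<eta> / 3" using \<eta> by simp
  from daugavet_weakly_compact_sum[where B = B, OF D B0 K BK S(1) k(1) kS this]
  obtain x y where "norm x \<le> 1" "norm y \<le> 1" "1 + (?L - 2 * \<eta> / 3) - \<eta> / 3 \<le> norm (B0 x y + B x y)"
    by metis
  then show "\<exists>x y. norm x \<le> 1 \<and> norm y \<le> 1 \<and> 1 + ?L - \<eta>' \<le> norm (B0 x y + B x y)"
    using \<eta> by (intro exI[of _ x] exI[of _ y]) auto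
qed

theorem corollary3p7:
  fixes B0 B :: "'x::banach \<Rightarrow> 'y::banach \<Rightarrow> 'z::banach"
  assumes "\<exists>z::'z. z \<noteq> 0"
    and "daugavet_property TYPE('z)"
    and "norming_bilinear B0"
    and "bounded_bilinear B"
  shows "((\<forall>\<epsilon>>0. \<exists>S0\<in>bilinear_slices B0. \<exists>z\<in>sphere 0 1.
              (\<lambda>(x, y). B x y) ` S0 \<subseteq> cball (bilinear_norm B *\<^sub>R z) \<epsilon>) \<longrightarrow>
            bilinear_norm (\<lambda>x y. B0 x y + B x y) = 1 + bilinear_norm B) \<and>
         (slices_le (operator_slices (linearisation B)) (bilinear_slices B0) \<and>
            weakly_compact_operator (linearisation B) \<longrightarrow>
            bilinear_norm (\<lambda>x y. B0 x y + B x y) = 1 + bilinear_norm B)"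
proof (intro conjI impI)
  assume "\<forall>\<epsilon>>0. \<exists>S0\<in>bilinear_slices B0. \<exists>z\<in>sphere 0 1.
    (\<lambda>(x, y). B x y) ` S0 \<subseteq> cball (bilinear_norm B *\<^sub>R z) \<epsilon>"
  then show "bilinear_norm (\<lambda>x y. B0 x y + B x y) = 1 + bilinear_norm B"
    using bilinear_norm_add_slice[OF assms(2-4)] by blast
next
  assume *: "slices_le (operator_slices (linearisation B)) (bilinear_slices B0) \<and>
    weakly_compact_operator (linearisation B)"
  show "bilinear_norm (\<lambda>x y. B0 x y + B x y) = 1 + bilinear_norm B"
  proof (cases "bilinear_norm B = 0")
    case False
    then show ?thesis
      using bilinear_norm_add_weakly_compact[OF assms(2-4)] * bilinear_norm_nonneg[OF assms(4)] by simp
  next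
    \<comment> \<open>\<open>B\<close> vanishes on the unit balls and the claim becomes that
      \<open>B0\<close> has norm one; the nonzero vector of the target supplies a unit vector whose
      multiples of norm below one are values of \<open>B0\<close>.\<close>
    case True
    obtain z :: 'z where z: "norm z = 1"
      using assms(1) by (metis norm_sgn)
    show ?thesis
    proof (rule bilinear_norm_add_eqI[OF assms(3,4)])
      fix \<eta> :: real assume \<eta>: "0 < \<eta>"
      \<comment> \<open>The \<open>max\<close> keeps \<open>t *\<^sub>R z\<close> in the open ball
        when \<open>\<eta>\<close> is large.\<close>
      define t where "t = max 0 (1 - \<eta>)"
      have "norm (t *\<^sub>R z) < 1" using \<eta> z by (auto simp: t_def)
      then obtain x y where xy: "norm x < 1" "norm y < 1" "B0 x y = t *\<^sub>R z"
        using norming_bilinear_onto[OF assms(3)] by metis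
      have "B x y = 0"
        using bilinear_norm_upper[OF assms(4), of x y] xy True by simp
      then show "\<exists>x y. norm x \<le> 1 \<and> norm y \<le> 1 \<and> 1 + bilinear_norm B - \<eta> \<le> norm (B0 x y + B x y)"
        using xy True z by (intro exI[of _ x] exI[of _ y]) (auto simp: t_def)
    qed
  qed
qed

end
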